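(* Let $n\ge 1$, let $b$ be a locally integrable function on $\mathbb{R}^n$ and let $0<\beta<1$. Suppose that $1<p<n/\beta$, $0<\lambda<n-\beta p$, $1/q=1/p-\beta/n$ and $\lambda/p=\mu/q$. Then the following statements are equivalent: (1) $b\in\dot{\Lambda}_{\beta}(\mathbb{R}^n)$ and $b\ge 0$. (2) The commutator $[b,M]$ is bounded from $L^{p,\lambda}(\mathbb{R}^n)$ to $L^{q,\mu}(\mathbb{R}^n)$.
   Context: Cubes have sides parallel to the coordinate axes; $|E|$ denotes Lebesgue measure. The Hardy-Littlewood maximal function is $$M(f)(x)=\sup_{Q\ni x}\frac{1}{|Q|}\int_Q|f(y)|\,dy,$$ the supremum being over all cubes $Q\subset\mathbb{R}^n$ containing $x$. For a locally integrable function $b$, the (nonlinear) commutator is $$[b,M](f)(x)=b(x)M(f)(x)-M(bf)(x).$$ "$[b,M]$ is bounded from $X$ to $Y$" means that there is a constant $C$ such that, for all $f\in X$, $[b,M](f)$ is well defined a.e. and $\|[b,M](f)\|_Y\le C\|f\|_X$. For $0<\beta<1$, a function $b$ belongs to the Lipschitz space $\dot{\Lambda}_{\beta}(\mathbb{R}^n)$ if there is a constant $C$ such that $|b(x)-b(y)|\le C|x-y|^{\beta}$ for all $x,y\in\mathbb{R}^n$. As usual, functions are identified if they agree almost everywhere, so for a locally integrable $b$, $b\in\dot{\Lambda}_{\beta}(\mathbb{R}^n)$ means that $b$ agrees a.e. with a function satisfying this condition, and $b\ge0$ is understood a.e. For $1\le p<\infty$ and $0\le\lambda\le n$, the Morrey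 space is $L^{p,\lambda}(\mathbb{R}^n)=\{f\in L^p_{\mathrm{loc}}(\mathbb{R}^n):\|f\|_{L^{p,\lambda}}<\infty\}$, where $$\|f\|_{L^{p,\lambda}}=\sup_Q\bigg(\frac{1}{|Q|^{\lambda/n}}\int_Q|f(x)|^p\,dx\bigg)^{1/p},$$ the supremum being over all cubes $Q\subset\mathbb{R}^n$. *)

theory Defs
  imports "HOL-Analysis.Analysis"
begin

definition cubes :: "(real ^ 'n) set set" where
  "cubes = {cbox a (\<chi> i. a $ i + l) | a l. 0 < l}"

definition locally_integrable :: "(real ^ 'n \<Rightarrow> real) \<Rightarrow> bool" where
  "locally_integrable f \<longleftrightarrow> (\<forall>K. compact K \<longrightarrow> set_integrable lebesgue K f)"

text \<open>The maximal function is extended-valued, and is meaningful also for functions that are not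
  locally integrable (such as \<open>b f\<close> may be).\<close>

definition maximal_function :: "(real ^ 'n \<Rightarrow> real) \<Rightarrow> real ^ 'n \<Rightarrow> ennreal" where
  "maximal_function f x =
     (SUP Q\<in>{Q\<in>cubes. x \<in> Q}. (\<integral>\<^sup>+ y\<in>Q. ennreal \<bar>f y\<bar> \<partial>lebesgue) / emeasure lebesgue Q)"

definition commutator_well_defined ::
    "(real ^ 'n \<Rightarrow> real) \<Rightarrow> (real ^ 'n \<Rightarrow> real) \<Rightarrow> real ^ 'n \<Rightarrow> bool" where
  "commutator_well_defined b f x \<longleftrightarrow>
     maximal_function f x < \<infinity> \<and> maximal_function (\<lambda>y. b y * f y) x < \<infinity>"

text \<open>\<open>[b, M](f)\<close>; the value is only meaningful at points where \<open>commutator_well_defined b f\<close>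
  holds, since \<open>enn2real\<close> sends infinity to zero.\<close>

definition maximal_commutator ::
    "(real ^ 'n \<Rightarrow> real) \<Rightarrow> (real ^ 'n \<Rightarrow> real) \<Rightarrow> real ^ 'n \<Rightarrow> real" where
  "maximal_commutator b f x =
     b x * enn2real (maximal_function f x) - enn2real (maximal_function (\<lambda>y. b y * f y) x)"

definition holder_continuous :: "real \<Rightarrow> (real ^ 'n \<Rightarrow> real) \<Rightarrow> bool" where
  "holder_continuous \<beta> g \<longleftrightarrow> (\<exists>C. \<forall>x y. \<bar>g x - g y\<bar> \<le> C * norm (x - y) powr \<beta>)"

text \<open>Functions are identified when they agree almost everywhere.\<close>

definition lipschitz_space :: "real \<Rightarrow> (real ^ 'n \<Rightarrow> real) set" where
  "lipschitz_space \<beta> = {b. \<exists>g. holder_continuous \<beta> g \<and> (AE x in lebesgue. b x = g x)}"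

definition Lp_loc :: "real \<Rightarrow> (real ^ 'n \<Rightarrow> real) set" where
  "Lp_loc p = {f. f \<in> borel_measurable lebesgue \<and>
     (\<forall>K. compact K \<longrightarrow> set_integrable lebesgue K (\<lambda>x. \<bar>f x\<bar> powr p))}"

text \<open>The norm is only meaningful for \<open>f \<in> Lp_loc p\<close>: the integral of a non-integrable function is
  zero by convention.\<close>

definition morrey_norm :: "real \<Rightarrow> real \<Rightarrow> (real ^ 'n \<Rightarrow> real) \<Rightarrow> ennreal" where
  "morrey_norm p lam f =
     (SUP Q\<in>cubes. ennreal
        ((1 / measure lebesgue Q powr (lam / real CARD('n)) *
          (LINT x:Q|lebesgue. \<bar>f x\<bar> powr p)) powr (1 / p)))"

definition morrey_space :: "real \<Rightarrow> real \<Rightarrow> (real ^ 'n \<Rightarrow> real) set" where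
  "morrey_space p lam = {f \<in> Lp_loc p. morrey_norm p lam f < \<infinity>}"

definition maximal_commutator_bounded ::
    "(real ^ 'n \<Rightarrow> real) \<Rightarrow> real \<Rightarrow> real \<Rightarrow> real \<Rightarrow> real \<Rightarrow> bool" where
  "maximal_commutator_bounded b p lam q \<mu> \<longleftrightarrow>
     (\<exists>C\<ge>0. \<forall>f \<in> morrey_space p lam.
        (AE x in lebesgue. commutator_well_defined b f x) \<and>
        maximal_commutator b f \<in> morrey_space q \<mu> \<and>
        morrey_norm q \<mu> (maximal_commutator b f) \<le> ennreal C * morrey_norm p lam f)"

end

theory Submission
  imports Defs
begin

text \<open>For the sufficiency of (1), \<open>\<bar>[b, M] f\<bar>\<close> is dominated pointwise by a constant times the fractional maximal
  function of order \<open>\<beta>\<close> of \<open>f\<close>. The Morrey bound on \<open>f\<close> and the Vitali covering lemma give, for the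
  fractional maximal function on a cube, a weak-type estimate whose exponent is larger than \<open>q\<close> (this is
  where \<open>lam > 0\<close> enters), so that Kolmogorov's argument yields the strong bound with exponent \<open>q\<close> without
  any interpolation and without splitting \<open>f\<close> into a local and a global part.

  For the converse, test on \<open>f = indicator Q\<close>: on \<open>Q\<close> the commutator is \<open>b - m\<close>, where
  \<open>m = M (b f)\<close> dominates both \<open>\<bar>b\<bar>\<close> (Lebesgue differentiation) and the average of \<open>b\<close> over \<open>Q\<close>. The
  resulting bound on the integral of \<open>\<bar>b - m\<bar>\<close> over \<open>Q\<close> therefore controls the negative part of \<open>b\<close> and
  the mean oscillation of \<open>b\<close>, and Campanato's theorem applies.\<close>

section \<open>Cubes\<close>

text \<open>The passage from exponent p to exponent q is made on level sets of
  \<open>F = \<bar>f\<bar> powr p\<close>. A value of the commutator above t at x forces a cube of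
  side l through x on which the integral of \<open>F\<close> exceeds
  \<open>(t / c) powr p * l powr \<gamma>\<close>, where \<open>\<gamma> = n - \<beta> * p\<close>.
  The Morrey bound caps that integral by \<open>A * l powr lam\<close>, hence caps l, and with it
  the factor \<open>l powr (n - \<gamma>)\<close> that separates the measure of the cube from its
  lower bound. The resulting decay exponent is \<open>r = p * (n - lam) / (\<gamma> - lam)\<close>,
  while \<open>q = n * p / \<gamma>\<close>; after clearing denominators, \<open>q < r\<close> reads
  \<open>lam * \<gamma> < lam * n\<close>. The scaling also fits: on a cube of side L the strong
  bound carries L to the power \<open>n + (lam - \<gamma>) * q / p\<close>, which is
  \<open>\<mu>\<close>.

  In the converse the same relations between the exponents turn the norm inequality for the
  indicator of a cube of side L into a bound by a multiple of \<open>L powr (n + \<beta>)\<close>,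
  the scaling that Campanato's theorem requires.\<close>

definition cube :: "real ^ 'n \<Rightarrow> real \<Rightarrow> (real ^ 'n) set" where
  "cube x l = cbox x (\<chi> i. x $ i + l)"

lemma cubes_eq: "cubes = {cube a l | a l. 0 < l}"
  by (simp add: cubes_def cube_def)

lemma mem_cube: "y \<in> cube x l \<longleftrightarrow> (\<forall>i. x $ i \<le> y $ i \<and> y $ i \<le> x $ i + l)"
  by (simp add: cube_def mem_box_cart)

text \<open>Puts cubes into the shape of the boxes in
  \<open>integrable_ccontinuous_explicit\<close>, the differentiation theorem behind
  \<open>AE_average_tendsto\<close>.\<close>

lemma cube_eq_One: "cube x l = cbox x (x + l *\<^sub>R One)" for x :: "real ^ 'n"
proof -
  have "(One :: real ^ 'n) $ i = 1" for i
    by (simp only: cart_eq_inner_axis) (simp add: axis_in_Basis_iff)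
  then have "(\<chi> i. x $ i + l) = x + l *\<^sub>R One"
    by (simp only: vec_eq_iff vec_lambda_beta vector_add_component vector_scaleR_component) simp
  then show ?thesis
    by (simp add: cube_def)
qed

lemma cube_lmeasurable [simp]: "cube x l \<in> lmeasurable"
  by (simp add: cube_def)

lemma cube_sets [measurable, simp]: "cube x l \<in> sets lebesgue"
  by (simp add: cube_def)

lemma compact_cube [simp]: "compact (cube x l)"
  by (simp add: cube_def compact_cbox)

lemma measure_cube: "measure lebesgue (cube x l) = l ^ CARD('n)" if "0 \<le> l" for x :: "real ^ 'n"
proof -
  have "cbox x (\<chi> i. x $ i + l) \<noteq> {}"
    using that by (auto simp: interval_ne_empty_cart)
  then show ?thesis
    using that by (simp add: cube_def content_cbox_cart)
qed

lemma emeasure_cube: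
  "emeasure lebesgue (cube x l) = ennreal (l ^ CARD('n))" if "0 \<le> l" for x :: "real ^ 'n"
  using that by (simp add: emeasure_eq_measure2 measure_cube)

lemma cubesE:
  assumes "Q \<in> cubes" obtains a l where "0 < l" "Q = cube a l"
  using assms by (auto simp: cubes_eq)

lemma cube_in_cubes [simp]: "0 < l \<Longrightarrow> cube a l \<in> cubes"
  by (auto simp: cubes_eq)

text \<open>The sum of the coordinate distances bounds the Euclidean distance, hence the factor
  \<open>CARD('n)\<close>; a square root would only improve constants.\<close>

lemma dist_cube_le: "dist x y \<le> real CARD('n) * l" if "x \<in> cube z l" "y \<in> cube z l" 
  for x :: "real ^ 'n" and l :: real
proof -
  have "dist x y \<le> (\<Sum>i\<in>UNIV. \<bar>(x - y) $ i\<bar>)"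
    unfolding dist_norm by (rule norm_le_l1_cart)
  also have "\<dots> \<le> (\<Sum>i\<in>(UNIV::'n set). l)"
  proof (rule sum_mono)
    fix i
    show "\<bar>(x - y) $ i\<bar> \<le> l"
      using that[unfolded mem_cube, THEN spec, of i] by simp linarith
  qed
  finally show ?thesis by simp
qed

lemma cball_subset_cube: "cball x r \<subseteq> cube (\<chi> i. x $ i - r) (2 * r)" for x :: "real ^ 'n"
proof
  fix y assume "y \<in> cball x r"
  then have "norm (x - y) \<le> r" by (simp add: dist_norm)
  then have "\<bar>x $ i - y $ i\<bar> \<le> r" for i
    using component_le_norm_cart[of "x - y" i] by simp
  then show "y \<in> cube (\<chi> i. x $ i - r) (2 * r)"
    by (simp add: mem_cube) (smt (verit, best))
qed

lemma measure_cball_le: "measure lebesgue (cball x r) \<le> (2 * r) ^ CARD('n)" if "0 \<le> r"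
  for x :: "real ^ 'n"
proof -
  have "measure lebesgue (cball x r) \<le> measure lebesgue (cube (\<chi> i. x $ i - r) (2 * r))"
    by (intro measure_mono_fmeasurable cball_subset_cube) auto
  then show ?thesis using that by (simp add: measure_cube)
qed

lemma powr_card: "l ^ CARD('n) = l powr CARD('n::finite)" if "0 < l" for l :: real
  using that by (simp add: powr_realpow)

section \<open>Weak-type estimates on Morrey spaces\<close>

text \<open>No a priori size restriction on the cubes is needed: the Morrey bound on \<open>F\<close> forces \<open>l \<le> L\<close> on the
  bad cubes, so the covering lemma applies and all of them lie in a fixed dilate of the given cube.\<close>

lemma weak_type:
  fixes F :: "real ^ 'n \<Rightarrow> ennreal" and A L lam \<gamma> \<tau> :: real
  assumes F: "F \<in> borel_measurable lebesgue"
    and morrey: "\<And>x l. 0 < l \<Longrightarrow> (\<integral>\<^sup>+ y\<in>cube x l. F y \<partial>lebesgue) \<le> ennreal (A * l powr lam)"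
    and A: "0 < A" and lam: "0 \<le> lam" "lam < \<gamma>" "\<gamma> \<le> CARD('n)"
    and L: "0 < L" and \<tau>: "A * L powr (lam - \<gamma>) \<le> \<tau>"
  shows "\<exists>E\<in>lmeasurable.
    {x \<in> cube a L. \<exists>z l. 0 < l \<and> x \<in> cube z l \<and>
        ennreal (\<tau> * l powr \<gamma>) < (\<integral>\<^sup>+ y\<in>cube z l. F y \<partial>lebesgue)} \<subseteq> E \<and>
    measure lebesgue E \<le> (30 * real CARD('n)) ^ CARD('n) * L powr CARD('n) *
      (A * L powr (lam - \<gamma>) / \<tau>) powr ((CARD('n) - lam) / (\<gamma> - lam))"
proof -
  define n where "n = real CARD('n)"
  have n: "1 \<le> n" by (simp add: n_def Suc_leI)
  have \<tau>0: "0 < \<tau>" using A L \<tau> by (smt (verit) mult_pos_pos powr_gt_zero)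
  define S where "S = {x \<in> cube a L. \<exists>z l. 0 < l \<and> x \<in> cube z l \<and>
        ennreal (\<tau> * l powr \<gamma>) < (\<integral>\<^sup>+ y\<in>cube z l. F y \<partial>lebesgue)}"
  have "\<forall>x\<in>S. \<exists>zl. 0 < snd zl \<and> x \<in> cube (fst zl) (snd zl) \<and>
        ennreal (\<tau> * snd zl powr \<gamma>) < (\<integral>\<^sup>+ y\<in>cube (fst zl) (snd zl). F y \<partial>lebesgue)"
    unfolding S_def by auto
  from bchoice[OF this] obtain zl where zl: "\<forall>x\<in>S. 0 < snd (zl x) \<and> x \<in> cube (fst (zl x)) (snd (zl x)) \<and>
        ennreal (\<tau> * snd (zl x) powr \<gamma>) < (\<integral>\<^sup>+ y\<in>cube (fst (zl x)) (snd (zl x)). F y \<partial>lebesgue)"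
    by blast
  define z where "z x = fst (zl x)" for x
  define l where "l x = snd (zl x)" for x
  define Q where "Q x = cube (z x) (l x)" for x
  have l0: "0 < l x" and xQ: "x \<in> Q x"
    and big: "ennreal (\<tau> * l x powr \<gamma>) < (\<integral>\<^sup>+ y\<in>Q x. F y \<partial>lebesgue)" if "x \<in> S" for x
    using that zl by (auto simp: Q_def z_def l_def)
  \<comment> \<open>\<open>B\<close> solves
    \<open>\<tau> * B powr \<gamma> = A * B powr lam\<close>: beyond this side length a bad cube
    would violate the Morrey bound.\<close>
  define B where "B = (A / \<tau>) powr (1 / (\<gamma> - lam))"
  have B0: "0 < B" using A \<tau>0 by (simp add: B_def)
  have lB: "l x \<le> B" if x: "x \<in> S" for x
  proof -
    have "ennreal (\<tau> * l x powr \<gamma>) < ennreal (A * l x powr lam)"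
      using big[OF x] morrey[OF l0[OF x]] unfolding Q_def by (rule less_le_trans)
    then have "\<tau> * l x powr \<gamma> < A * l x powr lam"
      using A \<tau>0 by (simp add: ennreal_less_iff)
    then have "l x powr (\<gamma> - lam) < A / \<tau>"
      using \<tau>0 l0[OF x] by (simp add: powr_diff field_simps)
    then have "(l x powr (\<gamma> - lam)) powr (1 / (\<gamma> - lam)) \<le> B"
      unfolding B_def using lam by (intro powr_mono2) auto
    then show ?thesis using l0[OF x] lam by (simp add: powr_powr)
  qed
  \<comment> \<open>The lower bound on \<open>\<tau>\<close> says exactly that this cap does not
    exceed the side of the given cube.\<close>
  have BL: "B \<le> L"
  proof -
    have "A / \<tau> \<le> L powr (\<gamma> - lam)"
      using \<tau> \<tau>0 L by (simp add: powr_diff field_simps)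
    then have "B \<le> (L powr (\<gamma> - lam)) powr (1 / (\<gamma> - lam))"
      unfolding B_def using lam A \<tau>0 by (intro powr_mono2) auto
    then show ?thesis using L lam by (simp add: powr_powr)
  qed
  \<comment> \<open>The balls are centred at the points of \<open>S\<close> themselves, with a bound
    for the diameter of \<open>Q i\<close> as radius. They contain the \<open>Q i\<close>, so
    disjoint balls yield disjoint cubes.\<close>
  obtain C where C: "countable C" "C \<subseteq> S"
    "pairwise (\<lambda>i j. disjnt (cball i (n * l i)) (cball j (n * l j))) C"
    "S \<subseteq> (\<Union>i\<in>C. cball i (5 * (n * l i)))"
  proof (rule Vitali_covering_lemma_cballs[where S = S and K = S and a = "\<lambda>x. x" and r = "\<lambda>x. n * l x" and B = "n * L"])
    show "S \<subseteq> (\<Union>i\<in>S. cball i (n * l i))"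
      using l0 n by force
    show "0 < n * l i \<and> n * l i \<le> n * L" if "i \<in> S" for i
      using l0[OF that] lB[OF that] BL n by auto
  qed (use that in auto)
  have Qball: "Q i \<subseteq> cball i (n * l i)" if "i \<in> S" for i
    using dist_cube_le[of i "z i" "l i"] xQ[OF that] by (auto simp: Q_def n_def)
  \<comment> \<open>A cube of side at most \<open>L\<close> that meets \<open>cube a L\<close> lies
    in its threefold dilate.\<close>
  define Q3 where "Q3 = cube (\<chi> i. a $ i - L) (3 * L)"
  have Q3: "Q i \<subseteq> Q3" if i: "i \<in> S" for i
  proof
    fix y assume y: "y \<in> Q i"
    have "l i \<le> L" using lB[OF i] BL by simp
    moreover have "i \<in> cube a L" using i by (simp add: S_def)
    ultimately show "y \<in> Q3"
      using y xQ[OF i] unfolding Q_def Q3_def mem_cube by simp (smt (verit))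
  qed
  define V where "V = (30 * real CARD('n)) ^ CARD('n) * L powr CARD('n) *
      (A * L powr (lam - \<gamma>) / \<tau>) powr ((CARD('n) - lam) / (\<gamma> - lam))"
  \<comment> \<open>A bound uniform over finite subfamilies is enough: it passes to the countable
    union by \<open>measure_UN_bound\<close>.\<close>
  have bound: "measure lebesgue (\<Union>i\<in>I. cball i (5 * (n * l i))) \<le> V"
    if I: "I \<subseteq> C" "finite I" for I
  proof -
    have IS: "i \<in> S" if "i \<in> I" for i using that I C by auto
    have "measure lebesgue (\<Union>i\<in>I. cball i (5 * (n * l i))) \<le> (\<Sum>i\<in>I. measure lebesgue (cball i (5 * (n * l i))))"
      using I by (intro measure_UNION_le) auto
    also have "\<dots> \<le> (\<Sum>i\<in>I. (10 * n) ^ CARD('n) * l i powr n)"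
    proof (rule sum_mono)
      fix i assume i: "i \<in> I"
      have "measure lebesgue (cball i (5 * (n * l i))) \<le> (2 * (5 * (n * l i))) ^ CARD('n)"
        using l0[OF IS[OF i]] n by (intro measure_cball_le) auto
      also have "\<dots> = (10 * n) ^ CARD('n) * l i powr n"
        using l0[OF IS[OF i]] by (simp add: power_mult_distrib powr_card n_def)
      finally show "measure lebesgue (cball i (5 * (n * l i))) \<le> (10 * n) ^ CARD('n) * l i powr n" .
    qed
    also have "\<dots> = (10 * n) ^ CARD('n) * (\<Sum>i\<in>I. l i powr n)"
      by (simp add: sum_distrib_left)
    finally have le1: "measure lebesgue (\<Union>i\<in>I. cball i (5 * (n * l i))) \<le> (10 * n) ^ CARD('n) * (\<Sum>i\<in>I. l i powr n)" .
    \<comment> \<open>The cap on the sides gives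
      \<open>l i powr n \<le> B powr (n - \<gamma>) * l i powr \<gamma>\<close>, badness replaces
      \<open>l i powr \<gamma>\<close> by an integral of \<open>F\<close>, and the integrals over
      the disjoint cubes add up inside \<open>Q3\<close>.\<close>
    have "(\<Sum>i\<in>I. l i powr n) \<le> B powr (n - \<gamma>) / \<tau> * (A * (3 * L) powr lam)"
    proof -
      have "(\<Sum>i\<in>I. \<integral>\<^sup>+ y\<in>Q i. F y \<partial>lebesgue) = (\<integral>\<^sup>+ y. (\<Sum>i\<in>I. F y * indicator (Q i) y) \<partial>lebesgue)"
        unfolding Q_def by (rule nn_integral_sum[symmetric]) (intro borel_measurable_times_ennreal F borel_measurable_indicator cube_sets)
      also have "\<dots> \<le> (\<integral>\<^sup>+ y\<in>Q3. F y \<partial>lebesgue)"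
      proof (rule nn_integral_mono)
        fix y
        have "disjoint_family_on Q I"
          unfolding disjoint_family_on_def
        proof (intro ballI impI)
          fix i j assume ij: "i \<in> I" "j \<in> I" "i \<noteq> j"
          then have "disjnt (cball i (n * l i)) (cball j (n * l j))"
            using C(3) I(1) by (auto intro: pairwiseD)
          then show "Q i \<inter> Q j = {}"
            using Qball[OF IS[OF ij(1)]] Qball[OF IS[OF ij(2)]] unfolding disjnt_def by blast
        qed
        then have "(\<Sum>i\<in>I. indicator (Q i) y :: ennreal) = indicator (\<Union>i\<in>I. Q i) y"
          using I by (intro indicator_UN_disjoint[symmetric]) auto
        also have "\<dots> \<le> indicator Q3 y"
          using Q3 IS by (auto simp: indicator_def)
        finally show "(\<Sum>i\<in>I. F y * indicator (Q i) y) \<le> F y * indicator Q3 y"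
          unfolding sum_distrib_left[symmetric] by (rule mult_left_mono) simp
      qed
      also have "\<dots> \<le> ennreal (A * (3 * L) powr lam)"
        unfolding Q3_def using L by (intro morrey) simp
      finally have sumF: "(\<Sum>i\<in>I. \<integral>\<^sup>+ y\<in>Q i. F y \<partial>lebesgue) \<le> ennreal (A * (3 * L) powr lam)" .
      have "ennreal (\<Sum>i\<in>I. l i powr n) = (\<Sum>i\<in>I. ennreal (l i powr n))"
        by (simp add: sum_ennreal)
      also have "\<dots> \<le> (\<Sum>i\<in>I. ennreal (B powr (n - \<gamma>) / \<tau>) * (\<integral>\<^sup>+ y\<in>Q i. F y \<partial>lebesgue))"
      proof (rule sum_mono)
        fix i assume "i \<in> I"
        then have i: "i \<in> S" by (rule IS)
        have "l i powr n = l i powr (n - \<gamma>) * l i powr \<gamma>"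
          by (simp flip: powr_add)
        also have "\<dots> \<le> B powr (n - \<gamma>) * l i powr \<gamma>"
          using l0[OF i] lB[OF i] lam by (intro mult_right_mono powr_mono2) (auto simp: n_def)
        also have "\<dots> = B powr (n - \<gamma>) / \<tau> * (\<tau> * l i powr \<gamma>)"
          using \<tau>0 by simp
        finally have "ennreal (l i powr n) \<le> ennreal (B powr (n - \<gamma>) / \<tau> * (\<tau> * l i powr \<gamma>))"
          by (rule ennreal_leI)
        also have "\<dots> = ennreal (B powr (n - \<gamma>) / \<tau>) * ennreal (\<tau> * l i powr \<gamma>)"
          using \<tau>0 by (intro ennreal_mult) auto
        also have "\<dots> \<le> ennreal (B powr (n - \<gamma>) / \<tau>) * (\<integral>\<^sup>+ y\<in>Q i. F y \<partial>lebesgue)"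
          using big[OF i] by (intro mult_left_mono) auto
        finally show "ennreal (l i powr n) \<le> \<dots>" .
      qed
      also have "\<dots> = ennreal (B powr (n - \<gamma>) / \<tau>) * (\<Sum>i\<in>I. \<integral>\<^sup>+ y\<in>Q i. F y \<partial>lebesgue)"
        by (simp add: sum_distrib_left)
      also have "\<dots> \<le> ennreal (B powr (n - \<gamma>) / \<tau>) * ennreal (A * (3 * L) powr lam)"
        by (rule mult_left_mono[OF sumF]) simp
      finally have "ennreal (\<Sum>i\<in>I. l i powr n) \<le>
          ennreal (B powr (n - \<gamma>) / \<tau>) * ennreal (A * (3 * L) powr lam)" .
      also have "\<dots> = ennreal (B powr (n - \<gamma>) / \<tau> * (A * (3 * L) powr lam))"
        using \<tau>0 A by (intro ennreal_mult[symmetric]) auto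
      finally show ?thesis
        using \<tau>0 A by (subst (asm) ennreal_le_iff) auto
    qed
    also have "B powr (n - \<gamma>) / \<tau> * (A * (3 * L) powr lam) = 3 powr lam * (L powr lam * (A / \<tau>) powr ((n - lam) / (\<gamma> - lam)))"
    proof -
      have "(n - lam) / (\<gamma> - lam) = (n - \<gamma>) / (\<gamma> - lam) + 1"
        using lam by (simp add: field_simps)
      then have "(A / \<tau>) powr ((n - lam) / (\<gamma> - lam)) = B powr (n - \<gamma>) * (A / \<tau>)"
        unfolding B_def powr_powr using A \<tau>0 by (simp add: powr_add)
      then show ?thesis using L by (simp add: powr_mult)
    qed
    also have "\<dots> \<le> 3 powr n * (L powr lam * (A / \<tau>) powr ((n - lam) / (\<gamma> - lam)))"
      using lam by (intro mult_right_mono powr_mono) (auto simp: n_def)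
    also have "L powr lam * (A / \<tau>) powr ((n - lam) / (\<gamma> - lam)) =
        L powr n * (A * L powr (lam - \<gamma>) / \<tau>) powr ((n - lam) / (\<gamma> - lam))"
    proof -
      have "(A * L powr (lam - \<gamma>) / \<tau>) powr ((n - lam) / (\<gamma> - lam)) =
          (A / \<tau>) powr ((n - lam) / (\<gamma> - lam)) * (L powr (lam - \<gamma>)) powr ((n - lam) / (\<gamma> - lam))"
        using A \<tau>0 by (subst powr_mult[symmetric]) auto
      also have "(L powr (lam - \<gamma>)) powr ((n - lam) / (\<gamma> - lam)) = L powr (lam - n)"
      proof -
        have "(lam - \<gamma>) * ((n - lam) / (\<gamma> - lam)) = lam - n"
          using lam by (simp add: field_simps)
        then show ?thesis by (simp add: powr_powr)
      qed
      finally show ?thesis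
        using L by (simp add: powr_diff field_simps)
    qed
    finally have le2: "(\<Sum>i\<in>I. l i powr n) \<le> 3 powr n * (L powr n * (A * L powr (lam - \<gamma>) / \<tau>) powr ((n - lam) / (\<gamma> - lam)))" .
    have "measure lebesgue (\<Union>i\<in>I. cball i (5 * (n * l i))) \<le>
      (10 * n) ^ CARD('n) * (3 powr n * (L powr n * (A * L powr (lam - \<gamma>) / \<tau>) powr ((n - lam) / (\<gamma> - lam))))"
      using n by (intro order_trans[OF le1] mult_left_mono[OF le2]) simp
    also have "\<dots> = V"
    proof -
      \<comment> \<open>The factor \<open>10 * n\<close> is \<open>2 * 5 * n\<close>, from the cube
        enclosing a dilated ball; the factor \<open>3\<close> comes from \<open>Q3\<close> through
        \<open>3 powr lam \<le> 3 powr n\<close>.\<close>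
      have "(30 * real CARD('n)) ^ CARD('n) = (10 * n) ^ CARD('n) * 3 powr n"
      proof -
        have "30 * real CARD('n) = (10 * n) * 3" by (simp add: n_def)
        then have "(30 * real CARD('n)) ^ CARD('n) = (10 * n) ^ CARD('n) * 3 ^ CARD('n)"
          by (simp only: power_mult_distrib)
        then show ?thesis by (simp add: n_def powr_realpow)
      qed
      then have "V = (10 * n) ^ CARD('n) * 3 powr n * L powr n *
          (A * L powr (lam - \<gamma>) / \<tau>) powr ((n - lam) / (\<gamma> - lam))"
        unfolding V_def by (simp only: n_def[symmetric])
      then show ?thesis by (simp only: mult.assoc)
    qed
    finally show ?thesis .
  qed
  \<comment> \<open>The union of balls is a measurable superset of \<open>S\<close>, so the
    measurability of \<open>S\<close> itself never comes up.\<close>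
  have "(\<Union>i\<in>C. cball i (5 * (n * l i))) \<in> lmeasurable"
    by (rule fmeasurable_UN_bound[OF C(1) _ bound]) auto
  moreover have "measure lebesgue (\<Union>i\<in>C. cball i (5 * (n * l i))) \<le> V"
    by (rule measure_UN_bound[OF C(1) _ bound]) auto
  ultimately show ?thesis
    using C(4) unfolding S_def[symmetric] V_def[symmetric] by blast
qed

text \<open>Here \<open>r\<close> is the weak exponent. The summand \<open>1\<close> accounts for
  the set where the function is small; the rest sums a geometric series over dyadic layers, with
  ratio \<open>2 powr (q - r)\<close>, with \<open>2 powr q\<close> from the upper end of each
  layer, and with the constant of \<open>weak_type\<close> in front.\<close>

definition kolmogorov_const :: "real \<Rightarrow> real \<Rightarrow> real \<Rightarrow> real" where
  "kolmogorov_const n r q = 1 + (30 * n) powr n * 2 powr q / (1 - 2 powr (q - r))"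

lemma kolmogorov_const_pos: "0 < kolmogorov_const n r q" if "q < r"
proof -
  have "2 powr (q - r) < (1::real)" using that by (simp add: powr_less_one)
  then show ?thesis by (simp add: kolmogorov_const_def add_pos_nonneg)
qed

text \<open>Kolmogorov's argument: on a set of measure \<open>L\<^sup>n\<close> the weak bound with exponent
  \<open>p * (n - lam) / (\<gamma> - lam)\<close> gives a strong one with any smaller exponent \<open>q\<close>.\<close>

lemma kolmogorov:
  fixes F :: "real ^ 'n \<Rightarrow> ennreal" and A L lam \<gamma> p q c :: real and h :: "real ^ 'n \<Rightarrow> real"
  assumes F: "F \<in> borel_measurable lebesgue"
    and morrey: "\<And>x l. 0 < l \<Longrightarrow> (\<integral>\<^sup>+ y\<in>cube x l. F y \<partial>lebesgue) \<le> ennreal (A * l powr lam)"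
    and A: "0 < A" and lam: "0 \<le> lam" "lam < \<gamma>" "\<gamma> \<le> CARD('n)"
    and L: "0 < L" and p: "0 < p" and q: "0 < q" "q < p * ((CARD('n) - lam) / (\<gamma> - lam))"
    and c: "0 < c" and h0: "\<And>x. 0 \<le> h x"
    and h: "AE x in lebesgue. \<forall>t>0. t < h x \<longrightarrow> (\<exists>z l. 0 < l \<and> x \<in> cube z l \<and>
        ennreal ((t / c) powr p * l powr \<gamma>) < (\<integral>\<^sup>+ y\<in>cube z l. F y \<partial>lebesgue))"
  shows "(\<integral>\<^sup>+ x\<in>cube a L. ennreal (h x powr q) \<partial>lebesgue) \<le>
    ennreal (kolmogorov_const CARD('n) (p * ((CARD('n) - lam) / (\<gamma> - lam))) q *
      (c powr q * A powr (q / p) * L powr (CARD('n) + (lam - \<gamma>) * q / p)))"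
proof -
  define n where "n = real CARD('n)"
  have n: "1 \<le> n" by (simp add: n_def Suc_leI)
  define s where "s = (n - lam) / (\<gamma> - lam)"
  have s: "0 < s" using lam by (simp add: s_def n_def)
  define \<rho> where "\<rho> = 2 powr (q - p * s)"
  have \<rho>: "0 < \<rho>" "\<rho> < 1"
    using q by (auto simp: \<rho>_def s_def n_def powr_less_one)
  \<comment> \<open>\<open>a0\<close> is the smallest \<open>\<tau>\<close> that
    \<open>weak_type\<close> admits on this cube, and \<open>T\<close> is the corresponding height
    of \<open>h\<close>, that is \<open>(T / c) powr p = a0\<close>. Below \<open>T\<close> the
    measure of the cube alone gives the bound.\<close>
  define a0 where "a0 = A * L powr (lam - \<gamma>)"
  have a0: "0 < a0" using A L by (simp add: a0_def)
  define T where "T = c * a0 powr (1 / p)"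
  have T: "0 < T" using c a0 by (simp add: T_def)
  define N where "N = (30 * n) powr n"
  have N: "N = (30 * real CARD('n)) ^ CARD('n)"
    using n by (simp add: N_def n_def powr_realpow)
  define S where "S k = {x \<in> cube a L. \<exists>z l. 0 < l \<and> x \<in> cube z l \<and>
        ennreal (2 powr (k * p) * a0 * l powr \<gamma>) < (\<integral>\<^sup>+ y\<in>cube z l. F y \<partial>lebesgue)}" for k :: nat
  have "\<exists>E\<in>lmeasurable. S k \<subseteq> E \<and> measure lebesgue E \<le> N * L powr n * 2 powr (- real k * p * s)" for k
  proof -
    have "1 * a0 \<le> 2 powr (k * p) * a0"
      using a0 p by (intro mult_right_mono) (auto simp: ge_one_powr_ge_zero)
    then have "\<exists>E\<in>lmeasurable. S k \<subseteq> E \<and> measure lebesgue E \<le> N * L powr n * (a0 / (2 powr (k * p) * a0)) powr s"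
      unfolding S_def a0_def N n_def s_def
      by (intro weak_type[OF F morrey A lam L]) auto
    moreover have "(a0 / (2 powr (k * p) * a0)) powr s = 2 powr (- real k * p * s)"
    proof -
      have "a0 / (2 powr (k * p) * a0) = 2 powr (- (k * p))"
        using a0 by (simp add: powr_minus field_simps)
      then show ?thesis by (simp add: powr_powr)
    qed
    ultimately show ?thesis by simp
  qed
  then obtain E where E: "\<And>k :: nat. E k \<in> lmeasurable" "\<And>k. S k \<subseteq> E k"
    "\<And>k. measure lebesgue (E k) \<le> N * L powr n * 2 powr (- real k * p * s)"
    by metis
  have [measurable]: "E k \<in> sets lebesgue" for k using E(1)[of k] by auto
  define d where "d k = (2 ^ Suc k * T) powr q" for k :: nat
  have d: "0 \<le> d k" for k by (simp add: d_def)
  \<comment> \<open>Values above \<open>T\<close> are sorted into layers from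
    \<open>2 ^ k * T\<close> to \<open>2 ^ Suc k * T\<close>, on which \<open>h x powr q\<close> is
    at most \<open>d k\<close>. The measurable sets \<open>E k\<close> stand in for the level sets
    of \<open>h\<close>.\<close>
  have "AE x in lebesgue. ennreal (h x powr q) * indicator (cube a L) x \<le>
      ennreal (T powr q) * indicator (cube a L) x + (\<Sum>k. ennreal (d k) * indicator (E k) x)"
    using h
  proof eventually_elim
    case (elim x)
    show ?case
    proof (cases "x \<in> cube a L")
      case x: True
      show ?thesis
      proof (cases "h x \<le> T")
        case True
        then have "h x powr q \<le> T powr q" using h0 q by (intro powr_mono2) auto
        then show ?thesis using x by (simp add: add_increasing2 ennreal_leI)
      next
        case False
        obtain k0 where "h x / T < 2 ^ k0"
          using real_arch_pow[of 2 "h x / T"] by auto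
        then have "h x \<le> 2 ^ k0 * T" using T by (simp add: field_simps)
        also have "\<dots> \<le> 2 ^ Suc k0 * T" using T by simp
        finally have k0: "h x \<le> 2 ^ Suc k0 * T" .
        \<comment> \<open>Minimality of \<open>k\<close> supplies the lower end
          \<open>2 ^ k * T < h x\<close> of the layer; for \<open>k = 0\<close> it is the case
          assumption \<open>T < h x\<close>.\<close>
        define k where "k = (LEAST k. h x \<le> 2 ^ Suc k * T)"
        have k: "h x \<le> 2 ^ Suc k * T"
          unfolding k_def by (rule LeastI[of _ k0]) (rule k0)
        have k': "2 ^ k * T < h x"
        proof (cases k)
          case (Suc j)
          then have "\<not> h x \<le> 2 ^ Suc j * T"
            unfolding k_def by (metis lessI not_less_Least)
          then show ?thesis using Suc by simp
        qed (use False in simp)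
        have "((2 ^ k * T) / c) powr p = 2 powr (k * p) * a0"
        proof -
          have "(2 ^ k * T) / c = 2 powr k * a0 powr (1 / p)"
            using c by (simp add: T_def powr_realpow)
          then show ?thesis
            using p a0 by (simp add: powr_mult powr_powr)
        qed
        moreover have "0 < 2 ^ k * T" using T by simp
        ultimately have "\<exists>z l. 0 < l \<and> x \<in> cube z l \<and>
            ennreal (2 powr (k * p) * a0 * l powr \<gamma>) < (\<integral>\<^sup>+ y\<in>cube z l. F y \<partial>lebesgue)"
          using elim[rule_format, of "2 ^ k * T"] k' by simp
        then have "x \<in> S k"
          using x unfolding S_def by simp
        then have "x \<in> E k" using E(2) by auto
        have "h x powr q \<le> d k" unfolding d_def using k h0 q by (intro powr_mono2) auto
        then have "ennreal (h x powr q) \<le> ennreal (d k) * indicator (E k) x"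
          using \<open>x \<in> E k\<close> by (simp add: ennreal_leI)
        also have "\<dots> \<le> (\<Sum>k. ennreal (d k) * indicator (E k) x)"
        proof -
          have "u k \<le> (\<Sum>j. u j)" for u :: "nat \<Rightarrow> ennreal"
            using sum_le_suminf[of u "{k}"] by simp
          then show ?thesis .
        qed
        finally show ?thesis using x by (simp add: add_increasing)
      qed
    qed simp
  qed
  then have "(\<integral>\<^sup>+ x\<in>cube a L. ennreal (h x powr q) \<partial>lebesgue) \<le>
      (\<integral>\<^sup>+ x. ennreal (T powr q) * indicator (cube a L) x + (\<Sum>k. ennreal (d k) * indicator (E k) x) \<partial>lebesgue)"
    by (rule nn_integral_mono_AE)
  also have "\<dots> = ennreal (T powr q) * emeasure lebesgue (cube a L) + (\<Sum>k. ennreal (d k) * emeasure lebesgue (E k))"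
    by (simp add: nn_integral_add nn_integral_suminf nn_integral_cmult_indicator)
  also have "\<dots> \<le> ennreal (T powr q * L powr n) + (\<Sum>k. ennreal (T powr q * L powr n * N * 2 powr q * \<rho> ^ k))"
  proof (intro add_mono suminf_le)
    show "ennreal (T powr q) * emeasure lebesgue (cube a L) \<le> ennreal (T powr q * L powr n)"
      using L by (subst emeasure_cube) (simp_all add: n_def powr_card flip: ennreal_mult)
    fix k
    have "ennreal (d k) * emeasure lebesgue (E k) = ennreal (d k * measure lebesgue (E k))"
      using E(1)[of k] d by (simp add: emeasure_eq_measure2 ennreal_mult)
    also have "\<dots> \<le> ennreal (d k * (N * L powr n * 2 powr (- real k * p * s)))"
      by (intro ennreal_leI mult_left_mono E d)
    \<comment> \<open>The growth \<open>2 powr (k * q)\<close> of the layers meets the decay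
      \<open>2 powr (- k * p * s)\<close> of their measures; \<open>q < p * s\<close> makes the
      ratio \<open>\<rho>\<close> smaller than one.\<close>
    also have "d k * (N * L powr n * 2 powr (- real k * p * s)) = T powr q * L powr n * N * 2 powr q * \<rho> ^ k"
    proof -
      have "d k = 2 powr (k * q) * 2 powr q * T powr q"
      proof -
        have "2 ^ Suc k * T = 2 powr (k + 1) * T"
          by (simp add: powr_add powr_realpow)
        then have "d k = 2 powr ((k + 1) * q) * T powr q"
          unfolding d_def using T by (simp only: powr_mult powr_powr)
        then show ?thesis by (simp add: powr_add distrib_right)
      qed
      moreover have "\<rho> ^ k = 2 powr (k * q) * 2 powr (- real k * p * s)"
        unfolding \<rho>_def by (simp add: powr_realpow[symmetric] powr_powr powr_add[symmetric] algebra_simps)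
      ultimately show ?thesis by (simp add: mult_ac)
    qed
    finally show "ennreal (d k) * emeasure lebesgue (E k) \<le> ennreal (T powr q * L powr n * N * 2 powr q * \<rho> ^ k)" .
  qed simp_all
  also have "(\<Sum>k. ennreal (T powr q * L powr n * N * 2 powr q * \<rho> ^ k)) =
      ennreal (T powr q * L powr n * N * 2 powr q * (1 / (1 - \<rho>)))"
    using \<rho> T n by (intro suminf_ennreal_eq sums_mult geometric_sums) (auto simp: N_def)
  also have "ennreal (T powr q * L powr n) + \<dots> = ennreal (kolmogorov_const n (p * s) q * (T powr q * L powr n))"
    using \<rho> by (subst ennreal_plus[symmetric]) (auto simp: N_def kolmogorov_const_def \<rho>_def algebra_simps)
  also have "T powr q * L powr n = c powr q * A powr (q / p) * L powr (n + (lam - \<gamma>) * q / p)"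
    using c a0 A L by (simp add: T_def a0_def powr_mult powr_powr powr_add)
  finally show ?thesis by (simp add: n_def s_def)
qed

text \<open>A point at which no \<open>t\<close> works lies in every level set of height
  \<open>2 ^ k * a0\<close>. By \<open>weak_type\<close> these are covered by sets whose measure
  decays geometrically in \<open>k\<close>, so the exceptional points of any cube form a null set,
  and countably many cubes exhaust the space. The case \<open>\<gamma> = n\<close> serves the
  finiteness of the maximal function, the case \<open>\<gamma> = n - \<beta> * p\<close> that of its
  fractional counterpart.\<close>

lemma AE_bounded_averages:
  fixes F :: "real ^ 'n \<Rightarrow> ennreal" and A lam \<gamma> :: real
  assumes F: "F \<in> borel_measurable lebesgue"
    and morrey: "\<And>x l. 0 < l \<Longrightarrow> (\<integral>\<^sup>+ y\<in>cube x l. F y \<partial>lebesgue) \<le> ennreal (A * l powr lam)"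
    and A: "0 < A" and lam: "0 \<le> lam" "lam < \<gamma>" "\<gamma> \<le> CARD('n)"
  shows "AE x in lebesgue. \<exists>t>0. \<forall>z l. 0 < l \<longrightarrow> x \<in> cube z l \<longrightarrow>
    (\<integral>\<^sup>+ y\<in>cube z l. F y \<partial>lebesgue) \<le> ennreal (t * l powr \<gamma>)"
proof -
  define s where "s = (CARD('n) - lam) / (\<gamma> - lam)"
  have s: "0 < s" using lam by (simp add: s_def)
  have local: "AE x in lebesgue. x \<in> cube a L \<longrightarrow> (\<exists>t>0. \<forall>z l. 0 < l \<longrightarrow> x \<in> cube z l \<longrightarrow>
    (\<integral>\<^sup>+ y\<in>cube z l. F y \<partial>lebesgue) \<le> ennreal (t * l powr \<gamma>))" if L: "0 < L" for a L
  proof -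
    define a0 where "a0 = A * L powr (lam - \<gamma>)"
    have a0: "0 < a0" using A L by (simp add: a0_def)
    define N where "N = (30 * real CARD('n)) ^ CARD('n) * L powr CARD('n)"
    define S where "S k = {x \<in> cube a L. \<exists>z l. 0 < l \<and> x \<in> cube z l \<and>
        ennreal (2 ^ k * a0 * l powr \<gamma>) < (\<integral>\<^sup>+ y\<in>cube z l. F y \<partial>lebesgue)}" for k :: nat
    have "\<exists>E\<in>lmeasurable. S k \<subseteq> E \<and> measure lebesgue E \<le> N * ((1 / 2) powr s) ^ k" for k
    proof -
      have "1 * a0 \<le> 2 ^ k * a0"
        using a0 by (intro mult_right_mono) auto
      then have "\<exists>E\<in>lmeasurable. S k \<subseteq> E \<and> measure lebesgue E \<le> N * (a0 / (2 ^ k * a0)) powr s"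
        unfolding S_def a0_def N_def s_def
        by (intro weak_type[OF F morrey A lam L]) auto
      moreover have "(a0 / (2 ^ k * a0)) powr s = ((1 / 2) powr s) ^ k"
      proof -
        have "a0 / (2 ^ k * a0) = (1 / 2) powr k"
          using a0 by (simp add: powr_realpow power_one_over)
        then show ?thesis
          by (simp add: powr_powr powr_realpow[symmetric] mult.commute)
      qed
      ultimately show ?thesis by simp
    qed
    then obtain E where E: "\<And>k. E k \<in> lmeasurable" "\<And>k. S k \<subseteq> E k"
      "\<And>k. measure lebesgue (E k) \<le> N * ((1 / 2) powr s) ^ k"
      by metis
    have I: "(\<Inter>k. E k) \<in> lmeasurable"
      using E(1) by (intro fmeasurable_INT) auto
    have "measure lebesgue (\<Inter>k. E k) \<le> N * ((1 / 2) powr s) ^ k" for k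
    proof -
      have "measure lebesgue (\<Inter>k. E k) \<le> measure lebesgue (E k)"
        using I E(1)[of k] by (intro measure_mono_fmeasurable) auto
      then show ?thesis using E(3)[of k] by linarith
    qed
    moreover have "(\<lambda>k. N * ((1 / 2) powr s) ^ k) \<longlonglongrightarrow> N * 0"
      using s by (intro tendsto_mult tendsto_const LIMSEQ_realpow_zero)
        (use powr_less_mono2[of s "1 / 2" 1] in auto)
    ultimately have "measure lebesgue (\<Inter>k. E k) \<le> 0"
      using LIMSEQ_le_const[of "\<lambda>k. N * ((1 / 2) powr s) ^ k" 0] by auto
    then have "emeasure lebesgue (\<Inter>k. E k) = 0"
      using I by (simp add: emeasure_eq_measure2 measure_le_0_iff)
    then have null: "(\<Inter>k. E k) \<in> null_sets lebesgue"
      using I by (auto simp: null_sets_def)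
    show ?thesis
    proof (rule AE_I'[OF null], rule subsetI)
      fix x
      assume "x \<in> {x \<in> space lebesgue. \<not> (x \<in> cube a L \<longrightarrow> (\<exists>t>0. \<forall>z l. 0 < l \<longrightarrow> x \<in> cube z l \<longrightarrow>
        (\<integral>\<^sup>+ y\<in>cube z l. F y \<partial>lebesgue) \<le> ennreal (t * l powr \<gamma>)))}"
      then have x: "x \<in> cube a L" and "\<And>t. 0 < t \<Longrightarrow> \<exists>z l. 0 < l \<and> x \<in> cube z l \<and>
        ennreal (t * l powr \<gamma>) < (\<integral>\<^sup>+ y\<in>cube z l. F y \<partial>lebesgue)"
        by (auto simp: not_le)
      then have "x \<in> S k" for k
        unfolding S_def using a0 by auto
      then show "x \<in> (\<Inter>k. E k)" using E(2) by blast
    qed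
  qed
  have "AE x in lebesgue. \<forall>m::nat. x \<in> cube (\<chi> i. - real (Suc m)) (2 * real (Suc m)) \<longrightarrow> (\<exists>t>0. \<forall>z l. 0 < l \<longrightarrow> x \<in> cube z l \<longrightarrow>
    (\<integral>\<^sup>+ y\<in>cube z l. F y \<partial>lebesgue) \<le> ennreal (t * l powr \<gamma>))"
    unfolding AE_all_countable by (intro allI local) simp
  then show ?thesis
  proof eventually_elim
    case (elim x)
    obtain m :: nat where m: "norm x \<le> m" using real_arch_simple by blast
    have "x \<in> cube (\<chi> i. - real (Suc m)) (2 * real (Suc m))"
      unfolding mem_cube
    proof
      fix i
      show "(\<chi> i. - real (Suc m)) $ i \<le> x $ i \<and> x $ i \<le> (\<chi> i. - real (Suc m)) $ i + 2 * real (Suc m)"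
        using m component_le_norm_cart[of x i] by simp linarith
    qed
    then show ?case using elim by blast
  qed
qed

section \<open>The maximal function and Morrey norms\<close>

lemma ennreal_mult_le_iff:
  fixes I T :: ennreal
  assumes "0 < c"
  shows "I * inverse (ennreal c) \<le> T \<longleftrightarrow> I \<le> T * ennreal c"
proof
  have *: "inverse (ennreal c) * ennreal c = 1"
    using assms by (simp add: inverse_ennreal ennreal_mult[symmetric])
  show "I \<le> T * ennreal c" if "I * inverse (ennreal c) \<le> T"
    using mult_right_mono[OF that, of "ennreal c"] by (simp add: mult.assoc *)
  show "I * inverse (ennreal c) \<le> T" if "I \<le> T * ennreal c"
    using mult_right_mono[OF that, of "inverse (ennreal c)"] by (simp add: mult.assoc * mult.commute[of "ennreal c"])
qed

text \<open>Reduces upper bounds to one cube at a time and removes the division. With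
  \<open>T\<close> the maximal function itself it gives the estimate of each single
  integral.\<close>

lemma maximal_function_le_iff:
  fixes f :: "real ^ 'n \<Rightarrow> real"
  shows "maximal_function f x \<le> T \<longleftrightarrow>
    (\<forall>z l. 0 < l \<longrightarrow> x \<in> cube z l \<longrightarrow> (\<integral>\<^sup>+ y\<in>cube z l. ennreal \<bar>f y\<bar> \<partial>lebesgue) \<le> T * ennreal (l ^ CARD('n)))"
proof -
  have "(\<integral>\<^sup>+ y\<in>cube z l. ennreal \<bar>f y\<bar> \<partial>lebesgue) / emeasure lebesgue (cube z l) \<le> T \<longleftrightarrow>
      (\<integral>\<^sup>+ y\<in>cube z l. ennreal \<bar>f y\<bar> \<partial>lebesgue) \<le> T * ennreal (l ^ CARD('n))" if "0 < l" for z l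
    using that by (subst emeasure_cube) (auto simp: divide_ennreal_def ennreal_mult_le_iff)
  then show ?thesis
    unfolding maximal_function_def SUP_le_iff cubes_eq by blast
qed

text \<open>If the average over a cube through \<open>x\<close> exceeds \<open>t\<close>, move every
  face outwards by a small \<open>e\<close>: the integral does not decrease and the volume changes
  continuously, so the strict inequality survives, and the enlarged cube contains the whole ball of
  radius \<open>e\<close> about \<open>x\<close>.\<close>

lemma open_maximal_function_greater: "open {x. t < maximal_function f x}"
  for f :: "real ^ 'n \<Rightarrow> real"
proof (subst open_contains_ball, intro ballI)
  fix x assume "x \<in> {x. t < maximal_function f x}"
  then have tx: "t < maximal_function f x" by simp
  then obtain r where r: "0 \<le> r" "t = ennreal r"
    by (cases t) (auto simp: top_unique)
  have "\<not> maximal_function f x \<le> t" using tx by simp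
  then obtain z l where zl: "0 < l" "x \<in> cube z l"
    "t * ennreal (l ^ CARD('n)) < (\<integral>\<^sup>+ y\<in>cube z l. ennreal \<bar>f y\<bar> \<partial>lebesgue)"
    unfolding maximal_function_le_iff by (auto simp: not_le)
  have "((\<lambda>e. ennreal (r * (l + 2 * e) ^ CARD('n))) \<longlongrightarrow> ennreal (r * (l + 2 * 0) ^ CARD('n))) (at_right 0)"
    by (intro tendsto_intros tendsto_ennrealI)
  moreover have "ennreal (r * (l + 2 * 0) ^ CARD('n)) < (\<integral>\<^sup>+ y\<in>cube z l. ennreal \<bar>f y\<bar> \<partial>lebesgue)"
    using zl r by (simp add: ennreal_mult)
  ultimately have "\<forall>\<^sub>F e in at_right 0. ennreal (r * (l + 2 * e) ^ CARD('n)) < (\<integral>\<^sup>+ y\<in>cube z l. ennreal \<bar>f y\<bar> \<partial>lebesgue)"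
    by (rule order_tendstoD)
  then have "\<forall>\<^sub>F e in at_right 0. 0 < e \<and> ennreal (r * (l + 2 * e) ^ CARD('n)) < (\<integral>\<^sup>+ y\<in>cube z l. ennreal \<bar>f y\<bar> \<partial>lebesgue)"
    using eventually_at_right_less[of "0::real"] by eventually_elim simp
  then obtain e where e: "0 < e" "ennreal (r * (l + 2 * e) ^ CARD('n)) < (\<integral>\<^sup>+ y\<in>cube z l. ennreal \<bar>f y\<bar> \<partial>lebesgue)"
    using eventually_happens'[OF trivial_limit_at_right_real] by blast
  have "ball x e \<subseteq> {x. t < maximal_function f x}"
  proof
    fix y assume y: "y \<in> ball x e"
    let ?Q = "cube (\<chi> i. z $ i - e) (l + 2 * e)"
    have "y \<in> ?Q"
      unfolding mem_cube
    proof
      fix i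
      have "\<bar>(x - y) $ i\<bar> < e"
        using component_le_norm_cart[of "x - y" i] y by (simp add: dist_norm)
      then show "(\<chi> i. z $ i - e) $ i \<le> y $ i \<and> y $ i \<le> (\<chi> i. z $ i - e) $ i + (l + 2 * e)"
        using zl(2)[unfolded mem_cube, THEN spec, of i] by simp linarith
    qed
    moreover have "cube z l \<subseteq> ?Q"
      using e by (auto simp: mem_cube) (smt (verit))+
    then have "(\<integral>\<^sup>+ y\<in>cube z l. ennreal \<bar>f y\<bar> \<partial>lebesgue) \<le> (\<integral>\<^sup>+ y\<in>?Q. ennreal \<bar>f y\<bar> \<partial>lebesgue)"
      by (intro nn_integral_mono mult_left_mono) (auto simp: indicator_def)
    with e have "t * ennreal ((l + 2 * e) ^ CARD('n)) < (\<integral>\<^sup>+ y\<in>?Q. ennreal \<bar>f y\<bar> \<partial>lebesgue)"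
      using r zl by (auto simp: ennreal_mult)
    moreover have "0 < l + 2 * e" using e zl by simp
    ultimately have "\<not> maximal_function f y \<le> t"
      unfolding maximal_function_le_iff by (meson not_le)
    then show "y \<in> {x. t < maximal_function f x}" by simp
  qed
  then show "\<exists>e>0. ball x e \<subseteq> {x. t < maximal_function f x}" using e by blast
qed

lemma borel_measurable_maximal_function [measurable]:
  "maximal_function f \<in> borel_measurable lebesgue" for f :: "real ^ 'n \<Rightarrow> real"
proof (rule borel_measurableI_greater)
  fix t
  show "{x \<in> space lebesgue. t < maximal_function f x} \<in> sets lebesgue"
    using open_maximal_function_greater[of t f] by (simp add: borel_open sets_completionI_sets)
qed

lemma borel_measurable_maximal_commutator:
  assumes [measurable]: "b \<in> borel_measurable lebesgue"
  shows "maximal_commutator b f \<in> borel_measurable lebesgue"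
  unfolding maximal_commutator_def[abs_def] by measurable

section \<open>Morrey norms expressed by nonnegative integrals\<close>

lemma powr_inverse_le_iff: "y powr (1 / p) \<le> a \<longleftrightarrow> y \<le> a powr p"
  if "0 < p" "0 \<le> y" "0 \<le> a" for y a p :: real
proof
  assume "y powr (1 / p) \<le> a"
  then have "(y powr (1 / p)) powr p \<le> a powr p"
    using that by (intro powr_mono2) auto
  then show "y \<le> a powr p" using that by (simp add: powr_powr)
next
  assume "y \<le> a powr p"
  then have "y powr (1 / p) \<le> (a powr p) powr (1 / p)"
    using that by (intro powr_mono2) auto
  then show "y powr (1 / p) \<le> a" using that by (simp add: powr_powr)
qed

lemma compact_subset_cube:
  fixes K :: "(real ^ 'n) set"
  assumes "compact K" obtains a L where "0 < L" "K \<subseteq> cube a L"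
proof -
  obtain r where r: "\<And>x. x \<in> K \<Longrightarrow> norm x \<le> r" "0 < r"
    using compact_imp_bounded[OF assms] by (auto simp: bounded_pos)
  have "K \<subseteq> cube (\<chi> i. 0 $ i - r) (2 * r)"
    using cball_subset_cube[of 0 r] r by (auto simp: subset_iff)
  then show ?thesis using that[of "2 * r"] r by auto
qed

text \<open>Membership and norm bound are treated together: the Lebesgue integral of a
  non-integrable function is zero, so the norm bound carries information only alongside
  integrability. The nonnegative integral encodes both at once, its finiteness on cubes giving
  integrability on all compact sets.\<close>

lemma morrey_space_norm_le_iff:
  fixes f :: "real ^ 'n \<Rightarrow> real"
  assumes p: "0 < p" and a: "0 \<le> a"
  shows "f \<in> morrey_space p lam \<and> morrey_norm p lam f \<le> ennreal a \<longleftrightarrow>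
    f \<in> borel_measurable lebesgue \<and>
    (\<forall>x l. 0 < l \<longrightarrow> (\<integral>\<^sup>+ y\<in>cube x l. ennreal (\<bar>f y\<bar> powr p) \<partial>lebesgue) \<le> ennreal (a powr p * l powr lam))"
    (is "?L \<longleftrightarrow> ?R")
proof -
  let ?I = "\<lambda>x l. LINT y:cube x l|lebesgue. \<bar>f y\<bar> powr p"
  let ?N = "\<lambda>x l. \<integral>\<^sup>+ y\<in>cube x l. ennreal (\<bar>f y\<bar> powr p) \<partial>lebesgue"
  have Neq: "?N x l = (\<integral>\<^sup>+ y. ennreal (indicator (cube x l) y *\<^sub>R \<bar>f y\<bar> powr p) \<partial>lebesgue)" for x l
    by (intro nn_integral_cong) (auto simp: indicator_def)
  have eq: "?N x l = ennreal (?I x l)" if "set_integrable lebesgue (cube x l) (\<lambda>y. \<bar>f y\<bar> powr p)" for x l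
    unfolding Neq set_lebesgue_integral_def using that
    by (intro nn_integral_eq_integral) (auto simp: set_integrable_def)
  have I0: "0 \<le> ?I x l" for x l
    unfolding set_lebesgue_integral_def by (intro integral_nonneg_AE) auto
  have norm_le: "ennreal ((1 / measure lebesgue (cube x l) powr (lam / real CARD('n)) * ?I x l) powr (1 / p)) \<le> ennreal a
      \<longleftrightarrow> ?I x l \<le> a powr p * l powr lam" if l: "0 < l" for x l
  proof -
    have "measure lebesgue (cube x l) powr (lam / real CARD('n)) = l powr lam"
      using l by (simp add: measure_cube powr_card powr_powr)
    then show ?thesis
      using l I0[of x l] a p by (simp add: powr_inverse_le_iff pos_divide_le_eq)
  qed
  show ?thesis
  proof
    assume L: ?L
    then have meas: "f \<in> borel_measurable lebesgue" and int: "\<And>x l. set_integrable lebesgue (cube x l) (\<lambda>y. \<bar>f y\<bar> powr p)"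
      by (auto simp: morrey_space_def Lp_loc_def)
    have "?N x l \<le> ennreal (a powr p * l powr lam)" if l: "0 < l" for x l
    proof -
      have "ennreal ((1 / measure lebesgue (cube x l) powr (lam / real CARD('n)) * ?I x l) powr (1 / p)) \<le> ennreal a"
        using L l by (auto simp: morrey_norm_def SUP_le_iff)
      then show ?thesis
        unfolding eq[OF int] norm_le[OF l] by (rule ennreal_leI)
    qed
    then show ?R using meas by auto
  next
    assume R: ?R
    then have meas [measurable]: "f \<in> borel_measurable lebesgue" by simp
    have int: "set_integrable lebesgue (cube x l) (\<lambda>y. \<bar>f y\<bar> powr p)" if l: "0 < l" for x l
      unfolding set_integrable_def
    proof (rule integrableI_nonneg)
      have "?N x l \<le> ennreal (a powr p * l powr lam)" using R l by blast
      also have "\<dots> < \<infinity>" by simp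
      finally show "(\<integral>\<^sup>+ y. ennreal (indicator (cube x l) y *\<^sub>R \<bar>f y\<bar> powr p) \<partial>lebesgue) < \<infinity>"
        by (simp only: Neq)
    qed auto
    have "set_integrable lebesgue K (\<lambda>y. \<bar>f y\<bar> powr p)" if K: "compact K" for K
    proof -
      obtain x l where "0 < l" "K \<subseteq> cube x l" using compact_subset_cube[OF K] .
      moreover have "K \<in> sets lebesgue" using K lmeasurable_compact by blast
      ultimately show ?thesis using int set_integrable_subset by blast
    qed
    then have "f \<in> Lp_loc p" by (simp add: Lp_loc_def)
    moreover have "morrey_norm p lam f \<le> ennreal a"
      unfolding morrey_norm_def
    proof (rule SUP_least)
      fix Q :: "(real ^ 'n) set" assume "Q \<in> cubes"
      then obtain x l where l: "0 < l" "Q = cube x l" by (rule cubesE)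
      have "?N x l \<le> ennreal (a powr p * l powr lam)" using R l by blast
      then show "ennreal ((1 / measure lebesgue Q powr (lam / real CARD('n)) * (LINT y:Q|lebesgue. \<bar>f y\<bar> powr p)) powr (1 / p)) \<le> ennreal a"
        unfolding l norm_le[OF l(1)] eq[OF int[OF l(1)]]
        using l by (subst (asm) ennreal_le_iff) auto
    qed
    ultimately show ?L
      using ennreal_less_top[of a] by (auto simp: morrey_space_def intro: le_less_trans)
  qed
qed

lemma borel_measurable_locally_integrable:
  fixes b :: "real ^ 'n \<Rightarrow> real"
  assumes "locally_integrable b"
  shows "b \<in> borel_measurable lebesgue"
proof (rule borel_measurable_LIMSEQ_real)
  fix x
  show "(\<lambda>k. indicator (cball 0 (real k)) x *\<^sub>R b x) \<longlonglongrightarrow> b x"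
  proof (rule tendsto_eventually)
    obtain k :: nat where "norm x \<le> k" using real_arch_simple by blast
    then show "\<forall>\<^sub>F k in sequentially. indicator (cball 0 (real k)) x *\<^sub>R b x = b x"
      by (intro eventually_sequentiallyI[of k]) (auto simp: indicator_def)
  qed
next
  show "(\<lambda>x. indicator (cball 0 (real k)) x *\<^sub>R b x) \<in> borel_measurable lebesgue" for k
    using assms unfolding locally_integrable_def set_integrable_def
    by (intro borel_measurable_integrable) (simp only: compact_cball)
qed

text \<open>Young's inequality \<open>u \<le> c + c\<^sup>1\<^sup>-\<^sup>p u\<^sup>p\<close> replaces Hoelder's at the cost of a constant.\<close>

lemma young_powr: "u \<le> c + c powr (1 - p) * u powr p" if "0 < c" "0 \<le> u" "1 \<le> p" for u c p :: real
proof (cases "u \<le> c")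
  case False
  then have "u = c powr (1 - p) * (c powr (p - 1) * u)"
    using that by (simp add: powr_diff)
  also have "\<dots> \<le> c powr (1 - p) * (u powr (p - 1) * u)"
    using that False by (intro mult_left_mono mult_right_mono powr_mono2) auto
  also have "u powr (p - 1) * u = u powr p"
    using that False by (simp add: powr_diff)
  finally show ?thesis using that by linarith
qed (use that in \<open>simp add: add_increasing2\<close>)

lemma nn_integral_cube_young:
  fixes f :: "real ^ 'n \<Rightarrow> real"
  assumes f [measurable]: "f \<in> borel_measurable lebesgue" and c: "0 < c" and l: "0 \<le> l" and p: "1 \<le> p"
    and B: "(\<integral>\<^sup>+ y\<in>cube z l. ennreal (\<bar>f y\<bar> powr p) \<partial>lebesgue) \<le> ennreal B" "0 \<le> B"
  shows "(\<integral>\<^sup>+ y\<in>cube z l. ennreal \<bar>f y\<bar> \<partial>lebesgue) \<le> ennreal (c * l ^ CARD('n) + c powr (1 - p) * B)"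
proof -
  have "(\<integral>\<^sup>+ y\<in>cube z l. ennreal \<bar>f y\<bar> \<partial>lebesgue) \<le>
      (\<integral>\<^sup>+ y. ennreal c * indicator (cube z l) y + ennreal (c powr (1 - p)) * (ennreal (\<bar>f y\<bar> powr p) * indicator (cube z l) y) \<partial>lebesgue)"
  proof (rule nn_integral_mono)
    fix y
    have "ennreal \<bar>f y\<bar> \<le> ennreal (c + c powr (1 - p) * \<bar>f y\<bar> powr p)"
      using c p by (intro ennreal_leI young_powr) auto
    also have "\<dots> = ennreal c + ennreal (c powr (1 - p)) * ennreal (\<bar>f y\<bar> powr p)"
      using c by (simp add: ennreal_mult)
    finally show "ennreal \<bar>f y\<bar> * indicator (cube z l) y \<le> ennreal c * indicator (cube z l) y + ennreal (c powr (1 - p)) * (ennreal (\<bar>f y\<bar> powr p) * indicator (cube z l) y)"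
      by (simp add: indicator_def)
  qed
  also have "\<dots> = ennreal c * emeasure lebesgue (cube z l) + ennreal (c powr (1 - p)) * (\<integral>\<^sup>+ y\<in>cube z l. ennreal (\<bar>f y\<bar> powr p) \<partial>lebesgue)"
    by (subst nn_integral_add) (auto simp: nn_integral_cmult nn_integral_cmult_indicator)
  also have "\<dots> \<le> ennreal c * ennreal (l ^ CARD('n)) + ennreal (c powr (1 - p)) * ennreal B"
    using B by (intro add_mono mult_left_mono) (simp_all only: emeasure_cube[OF l] zero_le order_refl)
  also have "\<dots> = ennreal (c * l ^ CARD('n) + c powr (1 - p) * B)"
    using c l B by (simp add: ennreal_mult)
  finally show ?thesis .
qed

text \<open>The choice \<open>c = t * l powr - \<alpha>\<close> makes both terms of Young's
  inequality equal to \<open>t * l powr (n - \<alpha>)\<close>, whence the factor \<open>2\<close>.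
  The case \<open>\<alpha> = 0\<close> concerns the maximal function,
  \<open>\<alpha> = \<beta>\<close> the fractional one.\<close>

lemma nn_integral_cube_le_fractional:
  fixes f :: "real ^ 'n \<Rightarrow> real" and \<alpha> p t l :: real
  assumes f: "f \<in> borel_measurable lebesgue" and t: "0 < t" and l: "0 < l" and p: "1 \<le> p"
    and B: "(\<integral>\<^sup>+ y\<in>cube z l. ennreal (\<bar>f y\<bar> powr p) \<partial>lebesgue) \<le> ennreal (t powr p * l powr (CARD('n) - \<alpha> * p))"
  shows "(\<integral>\<^sup>+ y\<in>cube z l. ennreal \<bar>f y\<bar> \<partial>lebesgue) \<le> ennreal (2 * t * l powr (CARD('n) - \<alpha>))"
proof -
  have "(\<integral>\<^sup>+ y\<in>cube z l. ennreal \<bar>f y\<bar> \<partial>lebesgue) \<le>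
      ennreal ((t * l powr - \<alpha>) * l ^ CARD('n) + (t * l powr - \<alpha>) powr (1 - p) * (t powr p * l powr (CARD('n) - \<alpha> * p)))"
    using t l p by (intro nn_integral_cube_young[OF f _ _ _ B]) auto
  also have "(t * l powr - \<alpha>) * l ^ CARD('n) = t * l powr (CARD('n) - \<alpha>)"
    using l by (simp add: powr_card powr_diff powr_minus field_simps)
  also have "(t * l powr - \<alpha>) powr (1 - p) * (t powr p * l powr (CARD('n) - \<alpha> * p)) = t * l powr (CARD('n) - \<alpha>)"
  proof -
    have "(t * l powr - \<alpha>) powr (1 - p) = t powr (1 - p) * l powr (- \<alpha> * (1 - p))"
      using t l by (simp add: powr_mult powr_powr)
    then have "(t * l powr - \<alpha>) powr (1 - p) * (t powr p * l powr (CARD('n) - \<alpha> * p)) =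
        (t powr (1 - p) * t powr p) * (l powr (- \<alpha> * (1 - p)) * l powr (CARD('n) - \<alpha> * p))"
      by simp
    also have "\<dots> = t * l powr (CARD('n) - \<alpha>)"
      using t by (simp add: powr_add[symmetric] algebra_simps)
    finally show ?thesis .
  qed
  finally show ?thesis by (simp add: mult.assoc)
qed

lemma maximal_function_cmult:
  fixes f :: "real ^ 'n \<Rightarrow> real"
  assumes [measurable]: "f \<in> borel_measurable lebesgue" and "0 \<le> c"
  shows "maximal_function (\<lambda>y. c * f y) x = ennreal c * maximal_function f x"
proof -
  have "(\<integral>\<^sup>+ y\<in>Q. ennreal \<bar>c * f y\<bar> \<partial>lebesgue) = ennreal c * (\<integral>\<^sup>+ y\<in>Q. ennreal \<bar>f y\<bar> \<partial>lebesgue)" if "Q \<in> cubes" for Q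
  proof -
    have [measurable]: "Q \<in> sets lebesgue" using that by (auto elim: cubesE)
    show ?thesis
      using assms(2) by (subst nn_integral_cmult[symmetric]) (auto simp: abs_mult ennreal_mult mult.assoc)
  qed
  then show ?thesis
    unfolding maximal_function_def SUP_mult_left_ennreal
    by (intro SUP_cong) (auto simp: ennreal_times_divide)
qed

text \<open>On a cube of side \<open>l\<close> through \<open>x\<close>, replacing
  \<open>b y\<close> by the constant \<open>g x\<close> changes the integral of
  \<open>\<bar>b y * f y\<bar>\<close> by at most \<open>e * l powr \<beta>\<close> times that of
  \<open>\<bar>f\<bar>\<close>, thus by at most \<open>e * D * l ^ n\<close>. Averages change by at
  most \<open>e * D\<close>, uniformly over all cubes, so the maximal functions of
  \<open>b * f\<close> and of \<open>g x * f\<close> differ by at most \<open>e * D\<close> at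
  \<open>x\<close>; since \<open>0 \<le> g x\<close>, the latter is \<open>g x\<close> times that of
  \<open>f\<close>.\<close>

lemma maximal_commutator_pointwise:
  fixes b f g :: "real ^ 'n \<Rightarrow> real" and \<beta> C D :: real
  assumes b [measurable]: "b \<in> borel_measurable lebesgue" and f [measurable]: "f \<in> borel_measurable lebesgue"
    and bg: "AE y in lebesgue. b y = g y" "b x = g x" and gx: "0 \<le> g x"
    and hoelder: "\<And>y. \<bar>g x - g y\<bar> \<le> C * norm (x - y) powr \<beta>" and C: "0 \<le> C" and \<beta>: "0 \<le> \<beta>"
    and fin: "maximal_function f x < \<infinity>" and D: "0 \<le> D"
    and frac: "\<And>z l. 0 < l \<Longrightarrow> x \<in> cube z l \<Longrightarrow>
      (\<integral>\<^sup>+ y\<in>cube z l. ennreal \<bar>f y\<bar> \<partial>lebesgue) \<le> ennreal (D * l powr (CARD('n) - \<beta>))"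
  shows "maximal_function (\<lambda>y. b y * f y) x < \<infinity>"
    and "\<bar>maximal_commutator b f x\<bar> \<le> C * CARD('n) powr \<beta> * D"
proof -
  define e where "e = C * CARD('n) powr \<beta>"
  have e: "0 \<le> e" using C by (simp add: e_def)
  have diff: "\<bar>g x - g y\<bar> \<le> e * l powr \<beta>" if "x \<in> cube z l" "y \<in> cube z l" "0 < l" for y z l
  proof -
    have "\<bar>g x - g y\<bar> \<le> C * norm (x - y) powr \<beta>" by (rule hoelder)
    also have "\<dots> \<le> C * (CARD('n) * l) powr \<beta>"
      using dist_cube_le[OF that(1,2)] C \<beta> by (intro mult_left_mono powr_mono2) (auto simp: dist_norm)
    finally show ?thesis using that by (simp add: e_def powr_mult mult.assoc)
  qed
  have rest: "(\<integral>\<^sup>+ y\<in>cube z l. ennreal (e * l powr \<beta>) * ennreal \<bar>f y\<bar> \<partial>lebesgue) \<le> ennreal (e * D) * ennreal (l ^ CARD('n))"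
    if zl: "0 < l" "x \<in> cube z l" for z l
  proof -
    have "(\<integral>\<^sup>+ y\<in>cube z l. ennreal (e * l powr \<beta>) * ennreal \<bar>f y\<bar> \<partial>lebesgue) = ennreal (e * l powr \<beta>) * (\<integral>\<^sup>+ y\<in>cube z l. ennreal \<bar>f y\<bar> \<partial>lebesgue)"
      by (subst nn_integral_cmult[symmetric]) (auto simp: mult.assoc)
    also have "\<dots> \<le> ennreal (e * l powr \<beta>) * ennreal (D * l powr (CARD('n) - \<beta>))"
      using frac[OF zl] by (intro mult_left_mono) auto
    also have "\<dots> = ennreal (e * l powr \<beta> * (D * l powr (CARD('n) - \<beta>)))"
      using e D by (intro ennreal_mult[symmetric]) auto
    also have "e * l powr \<beta> * (D * l powr (CARD('n) - \<beta>)) = e * D * l ^ CARD('n)"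
      using zl by (simp add: powr_diff powr_card)
    also have "ennreal \<dots> = ennreal (e * D) * ennreal (l ^ CARD('n))"
      using e D zl by (intro ennreal_mult) auto
    finally show ?thesis .
  qed
  have upper: "maximal_function (\<lambda>y. b y * f y) x \<le> ennreal (g x) * maximal_function f x + ennreal (e * D)"
    unfolding maximal_function_cmult[OF f gx, symmetric] maximal_function_le_iff
  proof (intro allI impI)
    fix z l assume zl: "0 < l" "x \<in> cube z l"
    have "(\<integral>\<^sup>+ y\<in>cube z l. ennreal \<bar>b y * f y\<bar> \<partial>lebesgue) \<le>
        (\<integral>\<^sup>+ y. ennreal \<bar>g x * f y\<bar> * indicator (cube z l) y + ennreal (e * l powr \<beta>) * ennreal \<bar>f y\<bar> * indicator (cube z l) y \<partial>lebesgue)"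
    proof (rule nn_integral_mono_AE, use bg(1) in eventually_elim)
      case (elim y)
      have "ennreal \<bar>b y * f y\<bar> \<le> ennreal \<bar>g x * f y\<bar> + ennreal (e * l powr \<beta>) * ennreal \<bar>f y\<bar>" if "y \<in> cube z l"
      proof -
        have "\<bar>g y\<bar> \<le> \<bar>g x\<bar> + e * l powr \<beta>" using diff[OF zl(2) that zl(1)] by linarith
        then have "\<bar>b y * f y\<bar> \<le> (\<bar>g x\<bar> + e * l powr \<beta>) * \<bar>f y\<bar>"
          unfolding abs_mult elim by (rule mult_right_mono) simp
        then have "ennreal \<bar>b y * f y\<bar> \<le> ennreal (\<bar>g x * f y\<bar> + e * l powr \<beta> * \<bar>f y\<bar>)"
          by (intro ennreal_leI) (simp add: abs_mult distrib_right)
        then show ?thesis using e by (simp add: ennreal_mult)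
      qed
      then show ?case by (simp add: indicator_def)
    qed
    also have "\<dots> = (\<integral>\<^sup>+ y\<in>cube z l. ennreal \<bar>g x * f y\<bar> \<partial>lebesgue) + (\<integral>\<^sup>+ y\<in>cube z l. ennreal (e * l powr \<beta>) * ennreal \<bar>f y\<bar> \<partial>lebesgue)"
      by (rule nn_integral_add) auto
    also have "\<dots> \<le> maximal_function (\<lambda>y. g x * f y) x * ennreal (l ^ CARD('n)) + ennreal (e * D) * ennreal (l ^ CARD('n))"
      using zl rest[OF zl] maximal_function_le_iff[of "\<lambda>y. g x * f y" x "maximal_function (\<lambda>y. g x * f y) x"]
      by (intro add_mono) auto
    finally show "(\<integral>\<^sup>+ y\<in>cube z l. ennreal \<bar>b y * f y\<bar> \<partial>lebesgue) \<le> (maximal_function (\<lambda>y. g x * f y) x + ennreal (e * D)) * ennreal (l ^ CARD('n))"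
      by (simp add: distrib_right)
  qed
  have lower: "ennreal (g x) * maximal_function f x \<le> maximal_function (\<lambda>y. b y * f y) x + ennreal (e * D)"
    unfolding maximal_function_cmult[OF f gx, symmetric] maximal_function_le_iff[of "\<lambda>y. g x * f y"]
  proof (intro allI impI)
    fix z l assume zl: "0 < l" "x \<in> cube z l"
    have "(\<integral>\<^sup>+ y\<in>cube z l. ennreal \<bar>g x * f y\<bar> \<partial>lebesgue) \<le>
        (\<integral>\<^sup>+ y. ennreal \<bar>b y * f y\<bar> * indicator (cube z l) y + ennreal (e * l powr \<beta>) * ennreal \<bar>f y\<bar> * indicator (cube z l) y \<partial>lebesgue)"
    proof (rule nn_integral_mono_AE, use bg(1) in eventually_elim)
      case (elim y)
      have "ennreal \<bar>g x * f y\<bar> \<le> ennreal \<bar>b y * f y\<bar> + ennreal (e * l powr \<beta>) * ennreal \<bar>f y\<bar>" if "y \<in> cube z l"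
      proof -
        have "\<bar>g x\<bar> \<le> \<bar>g y\<bar> + e * l powr \<beta>" using diff[OF zl(2) that zl(1)] by linarith
        then have "\<bar>g x * f y\<bar> \<le> (\<bar>g y\<bar> + e * l powr \<beta>) * \<bar>f y\<bar>"
          unfolding abs_mult by (rule mult_right_mono) simp
        then have "ennreal \<bar>g x * f y\<bar> \<le> ennreal (\<bar>b y * f y\<bar> + e * l powr \<beta> * \<bar>f y\<bar>)"
          by (intro ennreal_leI) (simp add: abs_mult distrib_right elim)
        then show ?thesis using e by (simp add: ennreal_mult)
      qed
      then show ?case by (simp add: indicator_def)
    qed
    also have "\<dots> = (\<integral>\<^sup>+ y\<in>cube z l. ennreal \<bar>b y * f y\<bar> \<partial>lebesgue) + (\<integral>\<^sup>+ y\<in>cube z l. ennreal (e * l powr \<beta>) * ennreal \<bar>f y\<bar> \<partial>lebesgue)"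
      by (rule nn_integral_add) auto
    also have "\<dots> \<le> maximal_function (\<lambda>y. b y * f y) x * ennreal (l ^ CARD('n)) + ennreal (e * D) * ennreal (l ^ CARD('n))"
      using zl rest[OF zl] maximal_function_le_iff[of "\<lambda>y. b y * f y" x "maximal_function (\<lambda>y. b y * f y) x"]
      by (intro add_mono) auto
    finally show "(\<integral>\<^sup>+ y\<in>cube z l. ennreal \<bar>g x * f y\<bar> \<partial>lebesgue) \<le> (maximal_function (\<lambda>y. b y * f y) x + ennreal (e * D)) * ennreal (l ^ CARD('n))"
      by (simp add: distrib_right)
  qed
  \<comment> \<open>\<open>enn2real\<close> sends infinity to zero, so both maximal functions are
    identified with real numbers before they are subtracted; the estimate \<open>upper\<close>
    carries finiteness over from \<open>f\<close> to \<open>b * f\<close>.\<close>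
  obtain u where u: "0 \<le> u" "maximal_function f x = ennreal u"
    using fin by (cases "maximal_function f x") auto
  have "ennreal (g x) * ennreal u + ennreal (e * D) = ennreal (g x * u + e * D)"
    using gx u e D by (simp add: ennreal_mult)
  then have up: "maximal_function (\<lambda>y. b y * f y) x \<le> ennreal (g x * u + e * D)"
    using upper u by simp
  then show fin': "maximal_function (\<lambda>y. b y * f y) x < \<infinity>"
    by (rule le_less_trans) simp
  obtain v where v: "0 \<le> v" "maximal_function (\<lambda>y. b y * f y) x = ennreal v"
    using fin' by (cases "maximal_function (\<lambda>y. b y * f y) x") auto
  have "v \<le> g x * u + e * D"
    using up v gx u e D by (subst (asm) v(2), subst (asm) ennreal_le_iff) auto
  moreover have "ennreal (g x * u) \<le> ennreal (v + e * D)"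
    using lower u v gx e D by (simp add: ennreal_mult)
  then have "g x * u \<le> v + e * D"
    using v e D by (subst (asm) ennreal_le_iff) auto
  ultimately show "\<bar>maximal_commutator b f x\<bar> \<le> C * CARD('n) powr \<beta> * D"
    unfolding maximal_commutator_def u(2) v(2) bg(2) using u v by (simp add: e_def[symmetric])
qed

section \<open>Sufficiency\<close>

lemma lipschitz_imp_maximal_commutator_bounded:
  fixes b :: "real ^ 'n \<Rightarrow> real" and \<beta> p q lam \<mu> :: real
  assumes b: "locally_integrable b"
    and \<beta>: "0 < \<beta>"
    and p: "1 < p" and lam: "0 < lam" "lam < CARD('n) - \<beta> * p"
    and q: "1 / q = 1 / p - \<beta> / CARD('n)" and \<mu>: "lam / p = \<mu> / q"
    and lip: "b \<in> lipschitz_space \<beta>" and pos: "AE x in lebesgue. 0 \<le> b x"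
  shows "maximal_commutator_bounded b p lam q \<mu>"
proof -
  define n where "n = real CARD('n)"
  have n: "1 \<le> n" by (simp add: n_def Suc_leI)
  \<comment> \<open>With this exponent, a bound \<open>t powr p * l powr \<gamma>\<close> for the
    integral of \<open>\<bar>f\<bar> powr p\<close> over a cube gives the bound
    \<open>2 * t * l powr (n - \<beta>)\<close> for that of \<open>\<bar>f\<bar>\<close>.\<close>
  define \<gamma> where "\<gamma> = n - \<beta> * p"
  have \<gamma>: "lam < \<gamma>" "0 < \<gamma>" "\<gamma> < n" using lam \<beta> p by (auto simp: \<gamma>_def n_def)
  have "1 / q = \<gamma> / (n * p)"
    using q n p by (simp add: \<gamma>_def n_def field_simps)
  then have q_eq: "q = n * p / \<gamma>"
    by (metis divide_divide_eq_right div_by_1 mult_1)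
  have q0: "0 < q" using q_eq n p \<gamma> by simp
  have \<mu>_eq: "\<mu> = lam * q / p" using \<mu> q0 by (simp add: field_simps)
  \<comment> \<open>At \<open>lam = 0\<close> the two sides would coincide and the geometric series
    in Kolmogorov's argument would diverge.\<close>
  have q_less: "q < p * ((n - lam) / (\<gamma> - lam))"
  proof -
    have "n * (\<gamma> - lam) < (n - lam) * \<gamma>"
      using mult_strict_left_mono[OF \<gamma>(3) lam(1)] by (simp add: algebra_simps)
    then have "n / \<gamma> < (n - lam) / (\<gamma> - lam)"
      using \<gamma> by (simp add: divide_less_eq less_divide_eq field_simps)
    then have "p * (n / \<gamma>) < p * ((n - lam) / (\<gamma> - lam))"
      using p by (intro mult_strict_left_mono) auto
    then show ?thesis unfolding q_eq by (simp add: mult.commute)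
  qed
  have bm [measurable]: "b \<in> borel_measurable lebesgue"
    using b by (rule borel_measurable_locally_integrable)
  obtain g C0 where bg: "AE x in lebesgue. b x = g x"
    and C0: "\<And>x y. \<bar>g x - g y\<bar> \<le> C0 * norm (x - y) powr \<beta>"
    using lip by (auto simp: lipschitz_space_def holder_continuous_def)
  define C where "C = max C0 0 + 1"
  have C: "0 < C" by (simp add: C_def)
  have hoelder: "\<bar>g x - g y\<bar> \<le> C * norm (x - y) powr \<beta>" for x y
    by (rule order_trans[OF C0 mult_right_mono]) (auto simp: C_def)
  \<comment> \<open>The factor \<open>2\<close> comes from Young's inequality,
    \<open>C * n powr \<beta>\<close> from the pointwise estimate of the commutator. As
    \<open>c\<close> is used as a divisor, \<open>C\<close> has been made positive by adding
    \<open>1\<close>.\<close>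
  define c where "c = 2 * (C * n powr \<beta>)"
  have c: "0 < c" using C n by (simp add: c_def)
  define K where "K = kolmogorov_const n (p * ((n - lam) / (\<gamma> - lam))) q"
  have K: "0 < K" unfolding K_def using q_less by (rule kolmogorov_const_pos)
  define K' where "K' = K powr (1 / q) * c"
  have K': "0 \<le> K'" using c by (simp add: K'_def)
  \<comment> \<open>\<open>a\<close> is any positive majorant of the norm rather than the norm
    itself, because the weak-type estimate requires \<open>0 < A\<close> and the norm may
    vanish.\<close>
  have main: "(AE x in lebesgue. commutator_well_defined b f x) \<and>
      maximal_commutator b f \<in> morrey_space q \<mu> \<and>
      morrey_norm q \<mu> (maximal_commutator b f) \<le> ennreal (K' * a)"
    if f: "f \<in> morrey_space p lam" and a: "0 < a" and norm: "morrey_norm p lam f \<le> ennreal a" for f a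
  proof -
    have fm [measurable]: "f \<in> borel_measurable lebesgue"
      and morrey: "\<And>x l. 0 < l \<Longrightarrow> (\<integral>\<^sup>+ y\<in>cube x l. ennreal (\<bar>f y\<bar> powr p) \<partial>lebesgue) \<le> ennreal (a powr p * l powr lam)"
      using morrey_space_norm_le_iff[of p a f lam] f norm a p by auto
    have Fm: "(\<lambda>y. ennreal (\<bar>f y\<bar> powr p)) \<in> borel_measurable lebesgue" by measurable
    have ap: "0 < a powr p" using a by simp
    have AE1: "AE x in lebesgue. maximal_function f x < \<infinity>"
    proof -
      have "AE x in lebesgue. \<exists>t>0. \<forall>z l. 0 < l \<longrightarrow> x \<in> cube z l \<longrightarrow>
        (\<integral>\<^sup>+ y\<in>cube z l. ennreal (\<bar>f y\<bar> powr p) \<partial>lebesgue) \<le> ennreal (t * l powr n)"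
        using lam \<gamma> by (intro AE_bounded_averages[OF Fm morrey ap]) (auto simp: n_def)
      then show ?thesis
      proof eventually_elim
        case (elim x)
        then obtain t where t: "0 < t" "\<And>z l. 0 < l \<Longrightarrow> x \<in> cube z l \<Longrightarrow>
          (\<integral>\<^sup>+ y\<in>cube z l. ennreal (\<bar>f y\<bar> powr p) \<partial>lebesgue) \<le> ennreal (t * l powr n)" by blast
        define t' where "t' = t powr (1 / p)"
        have t': "0 < t'" "t' powr p = t" using t p by (auto simp: t'_def powr_powr)
        have "maximal_function f x \<le> ennreal (2 * t')"
          unfolding maximal_function_le_iff
        proof (intro allI impI)
          fix z l assume zl: "0 < l" "x \<in> cube z l"
          have "(\<integral>\<^sup>+ y\<in>cube z l. ennreal \<bar>f y\<bar> \<partial>lebesgue) \<le> ennreal (2 * t' * l powr (real CARD('n) - 0))"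
            using t' t(2)[OF zl] zl p by (intro nn_integral_cube_le_fractional[where p = p]) (auto simp: n_def)
          also have "2 * t' * l powr (real CARD('n) - 0) = 2 * t' * l ^ CARD('n)"
            using zl by (simp add: powr_card)
          finally show "(\<integral>\<^sup>+ y\<in>cube z l. ennreal \<bar>f y\<bar> \<partial>lebesgue) \<le> ennreal (2 * t') * ennreal (l ^ CARD('n))"
            using t' zl by (subst ennreal_mult[symmetric]) auto
        qed
        then show ?case by (rule le_less_trans) simp
      qed
    qed
    have frac: "(\<integral>\<^sup>+ y\<in>cube z l. ennreal \<bar>f y\<bar> \<partial>lebesgue) \<le> ennreal (2 * t * l powr (CARD('n) - \<beta>))"
      if "0 < t" "0 < l" "(\<integral>\<^sup>+ y\<in>cube z l. ennreal (\<bar>f y\<bar> powr p) \<partial>lebesgue) \<le> ennreal (t powr p * l powr \<gamma>)" for t z l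
      using that p by (intro nn_integral_cube_le_fractional[where p = p]) (auto simp: n_def \<gamma>_def)
    have AE2: "AE x in lebesgue. commutator_well_defined b f x"
    proof -
      have "AE x in lebesgue. \<exists>t>0. \<forall>z l. 0 < l \<longrightarrow> x \<in> cube z l \<longrightarrow>
        (\<integral>\<^sup>+ y\<in>cube z l. ennreal (\<bar>f y\<bar> powr p) \<partial>lebesgue) \<le> ennreal (t * l powr \<gamma>)"
        using lam \<gamma> by (intro AE_bounded_averages[OF Fm morrey ap]) (auto simp: n_def)
      then show ?thesis
        using AE1 bg pos
      proof eventually_elim
        case (elim x)
        then obtain t where t: "0 < t" "\<And>z l. 0 < l \<Longrightarrow> x \<in> cube z l \<Longrightarrow>
          (\<integral>\<^sup>+ y\<in>cube z l. ennreal (\<bar>f y\<bar> powr p) \<partial>lebesgue) \<le> ennreal (t * l powr \<gamma>)" by blast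
        define t' where "t' = t powr (1 / p)"
        have t': "0 < t'" "t' powr p = t" using t p by (auto simp: t'_def powr_powr)
        have "(\<integral>\<^sup>+ y\<in>cube z l. ennreal \<bar>f y\<bar> \<partial>lebesgue) \<le> ennreal (2 * t' * l powr (CARD('n) - \<beta>))"
          if zl: "0 < l" "x \<in> cube z l" for z l
          using t' t(2)[OF zl] zl by (intro frac) auto
        then have "maximal_function (\<lambda>y. b y * f y) x < \<infinity>"
          using t' elim \<beta> C
          by (intro maximal_commutator_pointwise(1)[OF bm fm bg _ _ hoelder, of _ "2 * t'"]) auto
        then show ?case using elim by (simp add: commutator_well_defined_def)
      qed
    qed
    have AE3: "AE x in lebesgue. \<forall>t>0. t < \<bar>maximal_commutator b f x\<bar> \<longrightarrow> (\<exists>z l. 0 < l \<and> x \<in> cube z l \<and>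
        ennreal ((t / c) powr p * l powr \<gamma>) < (\<integral>\<^sup>+ y\<in>cube z l. ennreal (\<bar>f y\<bar> powr p) \<partial>lebesgue))"
      using AE1 bg pos
    proof eventually_elim
      case (elim x)
      show ?case
      \<comment> \<open>If every cube through \<open>x\<close> satisfied the opposite inequality,
        the pointwise estimate with \<open>D = 2 * (t / c)\<close> would bound the commutator by
        \<open>t\<close>.\<close>
      proof (intro allI impI, rule ccontr)
        fix t assume t: "0 < t" "t < \<bar>maximal_commutator b f x\<bar>"
        assume "\<not> (\<exists>z l. 0 < l \<and> x \<in> cube z l \<and>
          ennreal ((t / c) powr p * l powr \<gamma>) < (\<integral>\<^sup>+ y\<in>cube z l. ennreal (\<bar>f y\<bar> powr p) \<partial>lebesgue))"
        then have *: "(\<integral>\<^sup>+ y\<in>cube z l. ennreal (\<bar>f y\<bar> powr p) \<partial>lebesgue) \<le> ennreal ((t / c) powr p * l powr \<gamma>)"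
          if "0 < l" "x \<in> cube z l" for z l
          using that by (meson not_le)
        have "(\<integral>\<^sup>+ y\<in>cube z l. ennreal \<bar>f y\<bar> \<partial>lebesgue) \<le> ennreal (2 * (t / c) * l powr (CARD('n) - \<beta>))"
          if zl: "0 < l" "x \<in> cube z l" for z l
          using t c zl *[OF zl] by (intro frac) auto
        then have "\<bar>maximal_commutator b f x\<bar> \<le> C * CARD('n) powr \<beta> * (2 * (t / c))"
          using t c elim \<beta> C
          by (intro maximal_commutator_pointwise(2)[OF bm fm bg _ _ hoelder]) auto
        also have "\<dots> = c * (t / c)" by (simp add: c_def n_def)
        also have "\<dots> = t" using c by simp
        finally show False using t by simp
      qed
    qed
    have "(\<integral>\<^sup>+ y\<in>cube x l. ennreal (\<bar>maximal_commutator b f y\<bar> powr q) \<partial>lebesgue) \<le> ennreal ((K' * a) powr q * l powr \<mu>)"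
      if l: "0 < l" for x l
    proof -
      have "(\<integral>\<^sup>+ y\<in>cube x l. ennreal (\<bar>maximal_commutator b f y\<bar> powr q) \<partial>lebesgue) \<le>
        ennreal (K * (c powr q * (a powr p) powr (q / p) * l powr (n + (lam - \<gamma>) * q / p)))"
        unfolding K_def n_def using lam \<gamma> l p q0 q_less c
        by (intro kolmogorov[OF Fm morrey ap _ _ _ _ _ _ _ _ _ AE3]) (auto simp: n_def)
      \<comment> \<open>\<open>\<gamma> * q / p = n\<close> cancels the dimension and leaves
        \<open>lam * q / p\<close>.\<close>
      also have "n + (lam - \<gamma>) * q / p = \<mu>"
        using p \<gamma> unfolding \<mu>_eq q_eq by (simp add: field_simps)
      also have "K * (c powr q * (a powr p) powr (q / p) * l powr \<mu>) = (K' * a) powr q * l powr \<mu>"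
        using K c a p q0 by (simp add: K'_def powr_mult powr_powr)
      finally show ?thesis .
    qed
    then have "maximal_commutator b f \<in> morrey_space q \<mu> \<and> morrey_norm q \<mu> (maximal_commutator b f) \<le> ennreal (K' * a)"
      using q0 K' a borel_measurable_maximal_commutator[OF bm, of f]
      by (subst morrey_space_norm_le_iff) auto
    then show ?thesis using AE2 by blast
  qed
  show ?thesis
    unfolding maximal_commutator_bounded_def
  proof (intro exI[of _ K'] conjI K' ballI)
    fix f :: "real ^ 'n \<Rightarrow> real" assume f: "f \<in> morrey_space p lam"
    then have "morrey_norm p lam f < \<infinity>" by (simp add: morrey_space_def)
    then obtain r where r: "0 \<le> r" "morrey_norm p lam f = ennreal r"
      by (cases "morrey_norm p lam f") auto
    have le: "morrey_norm p lam f \<le> ennreal (r + e)" if "0 < e" for e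
      using that r by (simp add: ennreal_leI)
    have main': "(AE x in lebesgue. commutator_well_defined b f x) \<and>
      maximal_commutator b f \<in> morrey_space q \<mu> \<and>
      morrey_norm q \<mu> (maximal_commutator b f) \<le> ennreal (K' * (r + e))" if "0 < e" for e
      using that r by (intro main[OF f] le) auto
    show "AE x in lebesgue. commutator_well_defined b f x" "maximal_commutator b f \<in> morrey_space q \<mu>"
      using main'[of 1] r by auto
    show "morrey_norm q \<mu> (maximal_commutator b f) \<le> ennreal K' * morrey_norm p lam f"
    \<comment> \<open>The positive majorants \<open>r + d\<close> of the norm \<open>r\<close> are
      removed in the limit.\<close>
    proof (rule ennreal_le_epsilon)
      fix e :: real assume e: "0 < e"
      define d where "d = e / (K' + 1)"
      have d: "0 < d" "K' * d \<le> e" using e K' by (auto simp: d_def field_simps)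
      have "morrey_norm q \<mu> (maximal_commutator b f) \<le> ennreal (K' * (r + d))"
        using main'[of d] d r by auto
      also have "\<dots> \<le> ennreal (K' * r + e)"
        using d by (intro ennreal_leI) (simp add: distrib_left)
      also have "\<dots> = ennreal K' * morrey_norm p lam f + ennreal e"
        using r K' e by (simp add: ennreal_mult)
      finally show "morrey_norm q \<mu> (maximal_commutator b f) \<le> ennreal K' * morrey_norm p lam f + ennreal e" .
    qed
  qed
qed

section \<open>Averages and Hoelder continuity\<close>

lemma cube_mono: "l \<le> l' \<Longrightarrow> cube x l \<subseteq> cube x l'"
  unfolding subset_iff mem_cube by (meson add_left_mono order_trans)

lemma set_integrable_cube:
  "locally_integrable b \<Longrightarrow> set_integrable lebesgue (cube a L) b"
  by (simp add: locally_integrable_def)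

lemma locally_integrable_const: "locally_integrable (\<lambda>_ :: real ^ 'n. c :: real)"
  unfolding locally_integrable_def set_integrable_def
proof (intro allI impI)
  fix K :: "(real ^ 'n) set" assume "compact K"
  then have "K \<in> lmeasurable" by (rule lmeasurable_compact)
  then show "integrable lebesgue (\<lambda>x. indicator K x *\<^sub>R c)"
    by (auto simp: fmeasurable_def intro!: integrable_real_indicator)
qed

lemma locally_integrable_abs: "locally_integrable (\<lambda>y. \<bar>b y\<bar>)" if "locally_integrable b"
  using that unfolding locally_integrable_def by (auto intro: set_integrable_abs)

lemma locally_integrable_diff:
  "locally_integrable (\<lambda>y. b y - c y)" if "locally_integrable b" "locally_integrable c"
  using that unfolding locally_integrable_def by (auto intro: set_integral_diff)

lemma LINT_cube_const: "(LINT y:cube a L|lebesgue. c) = c * L ^ CARD('n)" if "0 \<le> L"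
  for a :: "real ^ 'n" and c :: real
proof -
  have "(LINT y:cube a L|lebesgue. c) = c * measure lebesgue (cube a L)"
    unfolding set_lebesgue_integral_def by simp
  then show ?thesis using that by (simp add: measure_cube)
qed

lemma nn_integral_cube_eq_LINT:
  assumes "locally_integrable b" "\<And>y. 0 \<le> b y"
  shows "(\<integral>\<^sup>+ y\<in>cube a L. ennreal (b y) \<partial>lebesgue) = ennreal (LINT y:cube a L|lebesgue. b y)"
proof -
  have "(\<integral>\<^sup>+ y\<in>cube a L. ennreal (b y) \<partial>lebesgue) = (\<integral>\<^sup>+ y. ennreal (indicator (cube a L) y *\<^sub>R b y) \<partial>lebesgue)"
    by (intro nn_integral_cong) (auto simp: indicator_def)
  then show ?thesis
    using set_integrable_cube[OF assms(1), of a L] assms(2) unfolding set_lebesgue_integral_def set_integrable_def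
    by (simp add: nn_integral_eq_integral)
qed

definition average :: "(real ^ 'n \<Rightarrow> real) \<Rightarrow> real ^ 'n \<Rightarrow> real \<Rightarrow> real" where
  "average b a L = (LINT y:cube a L|lebesgue. b y) / L ^ CARD('n)"

text \<open>Lebesgue differentiation along the cubes having \<open>x\<close> as lower corner. These
  do not surround \<open>x\<close>, which is why the boundary of a cube is discarded in
  \<open>abs_le_maximal_function\<close>.\<close>

lemma AE_average_tendsto:
  fixes b :: "real ^ 'n \<Rightarrow> real"
  assumes b: "locally_integrable b"
  shows "AE x in lebesgue. (average b x \<longlongrightarrow> b x) (at_right 0)"
proof -
  have int: "b integrable_on cbox u v" for u v
    by (rule set_lebesgue_integral_eq_integral(1)) (use b in \<open>simp add: locally_integrable_def compact_cbox\<close>)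
  obtain N where N: "negligible N" and lim: "\<And>x e. x \<notin> N \<Longrightarrow> 0 < e \<Longrightarrow>
      \<exists>d>0. \<forall>h. 0 < h \<and> h < d \<longrightarrow> norm (integral (cbox x (x + h *\<^sub>R One)) b /\<^sub>R h ^ DIM(real ^ 'n) - b x) < e"
    by (rule integrable_ccontinuous_explicit[OF int]) (rule that)
  have "(average b x \<longlongrightarrow> b x) (at_right 0)" if x: "x \<notin> N" for x
  proof (rule tendstoI)
    fix e :: real assume "0 < e"
    then obtain d where d: "0 < d" "\<And>h. 0 < h \<Longrightarrow> h < d \<Longrightarrow>
        norm (integral (cbox x (x + h *\<^sub>R One)) b /\<^sub>R h ^ DIM(real ^ 'n) - b x) < e"
      using lim[OF x] by blast
    have eq: "integral (cbox x (x + h *\<^sub>R One)) b /\<^sub>R h ^ DIM(real ^ 'n) = average b x h" for h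
      unfolding average_def cube_eq_One[symmetric]
      using set_lebesgue_integral_eq_integral(2)[OF set_integrable_cube[OF b]]
      by (simp add: divide_inverse)
    have "\<forall>\<^sub>F h in at_right 0. 0 < h \<and> h < d"
      using d(1) by (intro eventually_conj eventually_at_right_less) (auto simp: eventually_at_right_field)
    then show "\<forall>\<^sub>F h in at_right 0. dist (average b x h) (b x) < e"
    proof eventually_elim
      case (elim h)
      then show ?case using d(2)[of h] unfolding eq by (simp add: dist_norm)
    qed
  qed
  then show ?thesis
    using N by (intro AE_I'[of N]) (auto simp: negligible_iff_null_sets)
qed

section \<open>Hoelder continuity from mean oscillation\<close>

text \<open>Split \<open>r powr \<beta>\<close>, for \<open>r = s + t\<close>, into the shares
  \<open>s / r\<close> and \<open>t / r\<close>. For \<open>u \<le> r\<close> the share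
  \<open>u * r powr (\<beta> - 1)\<close> is at most \<open>u * u powr (\<beta> - 1)\<close>, as the
  exponent is not positive. This is the triangle inequality for the metric of the extension
  below.\<close>

lemma powr_subadditive: "(s + t) powr \<beta> \<le> s powr \<beta> + t powr \<beta>"
  if "0 \<le> s" "0 \<le> t" "\<beta> \<le> 1" for s t \<beta> :: real
proof (cases "s + t = 0")
  case False
  define r where "r = s + t"
  have r: "0 < r" using False that by (simp add: r_def)
  have *: "u / r * r powr \<beta> \<le> u powr \<beta>" if u: "0 \<le> u" "u \<le> r" for u
  proof (cases "u = 0")
    case False
    have "r powr (\<beta> - 1) \<le> u powr (\<beta> - 1)"
      using False u \<open>\<beta> \<le> 1\<close> by (intro powr_mono2') auto
    then have "u * r powr (\<beta> - 1) \<le> u * u powr (\<beta> - 1)"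
      using u by (intro mult_left_mono) auto
    then show ?thesis using False u r by (simp add: powr_diff)
  qed simp
  have "r powr \<beta> = s / r * r powr \<beta> + t / r * r powr \<beta>"
    using r by (simp add: r_def add_divide_distrib[symmetric] distrib_right[symmetric])
  also have "\<dots> \<le> s powr \<beta> + t powr \<beta>"
    using that by (intro add_mono *) (auto simp: r_def)
  finally show ?thesis by (simp add: r_def)
qed (use that in auto)

text \<open>McShane's extension, for the metric \<open>dist x y powr \<beta>\<close>.\<close>

lemma holder_extension:
  fixes f :: "real ^ 'n \<Rightarrow> real"
  assumes f: "\<And>x y. x \<in> S \<Longrightarrow> y \<in> S \<Longrightarrow> \<bar>f x - f y\<bar> \<le> C * norm (x - y) powr \<beta>"
    and C: "0 \<le> C" and \<beta>: "0 < \<beta>" "\<beta> \<le> 1" and S: "S \<noteq> {}"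
  obtains g where "holder_continuous \<beta> g" "\<And>x. x \<in> S \<Longrightarrow> g x = f x"
proof
  define g where "g x = (INF y\<in>S. f y + C * norm (x - y) powr \<beta>)" for x
  have tri: "norm (x - z) powr \<beta> \<le> norm (x - y) powr \<beta> + norm (y - z) powr \<beta>" for x y z :: "real ^ 'n"
  proof -
    have "norm (x - z) powr \<beta> \<le> (norm (x - y) + norm (y - z)) powr \<beta>"
      using norm_triangle_ineq[of "x - y" "y - z"] \<beta> by (intro powr_mono2) auto
    also have "\<dots> \<le> norm (x - y) powr \<beta> + norm (y - z) powr \<beta>"
      using \<beta> by (intro powr_subadditive) auto
    finally show ?thesis .
  qed
  have Ctri: "C * norm (x - z) powr \<beta> \<le> C * norm (x - y) powr \<beta> + C * norm (y - z) powr \<beta>" for x y z :: "real ^ 'n"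
    using mult_left_mono[OF tri C] by (simp add: distrib_left)
  obtain s where s: "s \<in> S" using S by blast
  have bdd: "bdd_below ((\<lambda>y. f y + C * norm (x - y) powr \<beta>) ` S)" for x
  proof (rule bdd_belowI2)
    fix y assume y: "y \<in> S"
    show "f s - C * norm (s - x) powr \<beta> \<le> f y + C * norm (x - y) powr \<beta>"
      using f[OF s y] Ctri[of s y x] by linarith
  qed
  have le: "g x \<le> g y + C * norm (x - y) powr \<beta>" for x y
  proof -
    have "g x - C * norm (x - y) powr \<beta> \<le> f z + C * norm (y - z) powr \<beta>" if z: "z \<in> S" for z
    proof -
      have "g x \<le> f z + C * norm (x - z) powr \<beta>"
        unfolding g_def using bdd z by (rule cINF_lower)
      then show ?thesis using Ctri[of x z y] by linarith
    qed
    then have "g x - C * norm (x - y) powr \<beta> \<le> g y"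
      unfolding g_def[of y] using S by (intro cINF_greatest)
    then show ?thesis by linarith
  qed
  have "\<bar>g x - g y\<bar> \<le> C * norm (x - y) powr \<beta>" for x y
    using le[of x y] le[of y x] by (simp add: norm_minus_commute abs_le_iff)
  then show "holder_continuous \<beta> g"
    unfolding holder_continuous_def by blast
  show "g x = f x" if x: "x \<in> S" for x
  proof (rule antisym)
    have "g x \<le> f x + C * norm (x - x) powr \<beta>"
      unfolding g_def using bdd x by (rule cINF_lower)
    then show "g x \<le> f x" by simp
    show "f x \<le> g x"
      unfolding g_def using f[OF x] S by (intro cINF_greatest) (auto simp: abs_le_iff algebra_simps)
  qed
qed

lemma average_diff_le:
  fixes b :: "real ^ 'n \<Rightarrow> real"
  assumes b: "locally_integrable b" and l: "0 < l" and sub: "cube z l \<subseteq> cube a L"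
  shows "\<bar>average b z l - c\<bar> \<le> (LINT y:cube a L|lebesgue. \<bar>b y - c\<bar>) / l ^ CARD('n)"
proof -
  note li = locally_integrable_diff[OF b locally_integrable_const[of c]]
  have "average b z l - c = (LINT y:cube z l|lebesgue. b y - c) / l ^ CARD('n)"
    using l set_integrable_cube[OF b] set_integrable_cube[OF locally_integrable_const]
    by (simp add: average_def set_integral_diff LINT_cube_const diff_divide_distrib)
  then have "\<bar>average b z l - c\<bar> = \<bar>LINT y:cube z l|lebesgue. b y - c\<bar> / l ^ CARD('n)"
    using l by (simp add: abs_divide)
  also have "\<dots> \<le> (LINT y:cube z l|lebesgue. \<bar>b y - c\<bar>) / l ^ CARD('n)"
    using l set_integral_norm_bound[OF set_integrable_cube[OF li]] by (intro divide_right_mono) auto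
  also have "(LINT y:cube z l|lebesgue. \<bar>b y - c\<bar>) \<le> (LINT y:cube a L|lebesgue. \<bar>b y - c\<bar>)"
    using sub set_integrable_cube[OF locally_integrable_abs[OF li]]
    unfolding set_lebesgue_integral_def set_integrable_def
    by (intro integral_mono) (auto simp: indicator_def)
  finally show ?thesis using l by (simp add: divide_right_mono)
qed

text \<open>Averages over nested cubes whose sides have ratio two differ by a multiple of the side
  to the power \<open>\<beta>\<close>. Halving repeatedly at a Lebesgue point gives a geometric
  series, hence the distance from \<open>b x\<close> to its average; two points are compared through
  one cube enclosing a cube at each. The estimate holds only on \<open>S\<close>, and the extension
  supplies a representative everywhere.\<close>

lemma campanato:
  fixes b :: "real ^ 'n \<Rightarrow> real" and \<beta> K :: real
  assumes b: "locally_integrable b" and \<beta>: "0 < \<beta>" "\<beta> \<le> 1" and K: "0 \<le> K"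
    and osc: "\<And>a L. 0 < L \<Longrightarrow> (LINT y:cube a L|lebesgue. \<bar>b y - average b a L\<bar>) \<le> K * L powr (CARD('n) + \<beta>)"
  shows "b \<in> lipschitz_space \<beta>"
proof -
  define S where "S = {x. (average b x \<longlongrightarrow> b x) (at_right 0)}"
  \<comment> \<open>Dividing by the volume of the smaller cube rather than of the doubled one costs
    \<open>2 ^ n\<close>.\<close>
  define K2 where "K2 = K * 2 ^ CARD('n)"
  have K2: "0 \<le> K2" using K by (simp add: K2_def)
  have half: "\<bar>average b z L - average b a (2 * L)\<bar> \<le> K2 * (2 * L) powr \<beta>"
    if L: "0 < L" "cube z L \<subseteq> cube a (2 * L)" for z a L
  proof -
    have "\<bar>average b z L - average b a (2 * L)\<bar> \<le> (LINT y:cube a (2 * L)|lebesgue. \<bar>b y - average b a (2 * L)\<bar>) / L ^ CARD('n)"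
      using b L by (rule average_diff_le)
    also have "\<dots> \<le> (K * (2 * L) powr (CARD('n) + \<beta>)) / L ^ CARD('n)"
      using L by (intro divide_right_mono osc) auto
    also have "\<dots> = K2 * (2 * L) powr \<beta>"
      using L by (simp add: K2_def powr_add powr_card[symmetric] power_mult_distrib)
    finally show ?thesis .
  qed
  define \<rho> where "\<rho> = 2 powr (- \<beta>)"
  have \<rho>: "0 < \<rho>" "\<rho> < 1" using \<beta> by (auto simp: \<rho>_def powr_less_one)
  define C1 where "C1 = K2 / (1 - \<rho>)"
  have C1: "0 \<le> C1" using K2 \<rho> by (simp add: C1_def)
  have point: "\<bar>b x - average b x r\<bar> \<le> C1 * r powr \<beta>" if x: "x \<in> S" and r: "0 < r" for x r
  proof -
    define u where "u k = average b x (r / 2 ^ k)" for k :: nat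
    have step: "\<bar>u (Suc k) - u k\<bar> \<le> K2 * r powr \<beta> * \<rho> ^ k" for k
    proof -
      have eq: "2 * (r / 2 ^ Suc k) = r / 2 ^ k" by simp
      have "\<bar>u (Suc k) - u k\<bar> \<le> K2 * (2 * (r / 2 ^ Suc k)) powr \<beta>"
        unfolding u_def eq[symmetric] using r by (intro half) (auto intro!: cube_mono divide_left_mono)
      also have "(2 * (r / 2 ^ Suc k)) powr \<beta> = r powr \<beta> * \<rho> ^ k"
      proof -
        have "r / 2 ^ k = r * 2 powr (- real k)"
          by (simp add: powr_minus powr_realpow divide_inverse)
        then show ?thesis
          unfolding eq \<rho>_def using r by (simp add: powr_mult powr_powr powr_realpow[symmetric] mult.commute)
      qed
      finally show ?thesis by (simp add: mult.assoc)
    qed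
    have sum: "\<bar>u k - u 0\<bar> \<le> K2 * r powr \<beta> * (\<Sum>i<k. \<rho> ^ i)" for k
    proof (induction k)
      case (Suc k)
      then show ?case using step[of k] by (simp add: distrib_left)
    qed simp
    have bound: "\<bar>u k - u 0\<bar> \<le> C1 * r powr \<beta>" for k
    proof -
      have "(\<Sum>i<k. \<rho> ^ i) \<le> 1 / (1 - \<rho>)"
        using \<rho> by (simp add: sum_gp_strict divide_right_mono)
      then have "K2 * r powr \<beta> * (\<Sum>i<k. \<rho> ^ i) \<le> K2 * r powr \<beta> * (1 / (1 - \<rho>))"
        using K2 by (intro mult_left_mono) auto
      then show ?thesis using sum[of k] by (simp add: C1_def)
    qed
    have "filterlim (\<lambda>k. r / 2 ^ k) (at_right 0) sequentially"
    proof (rule tendsto_imp_filterlim_at_right)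
      have "(\<lambda>k. r * (1 / 2) ^ k) \<longlonglongrightarrow> r * 0"
        by (intro tendsto_mult tendsto_const LIMSEQ_realpow_zero) auto
      then show "(\<lambda>k. r / 2 ^ k) \<longlonglongrightarrow> 0" by (simp add: power_one_over)
    qed (use r in auto)
    then have "u \<longlonglongrightarrow> b x"
      unfolding u_def[abs_def] using x unfolding S_def by (auto intro: filterlim_compose)
    then have "(\<lambda>k. \<bar>u k - u 0\<bar>) \<longlonglongrightarrow> \<bar>b x - u 0\<bar>"
      by (intro tendsto_intros)
    then have "\<bar>b x - u 0\<bar> \<le> C1 * r powr \<beta>"
      using bound by (intro LIMSEQ_le_const2) auto
    then show ?thesis by (simp add: u_def)
  qed
  define C where "C = 2 * C1 + 2 * K2 * 2 powr \<beta>"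
  have C: "0 \<le> C" using C1 K2 by (simp add: C_def)
  have holder: "\<bar>b x - b y\<bar> \<le> C * norm (x - y) powr \<beta>" if xy: "x \<in> S" "y \<in> S" for x y
  proof (cases "x = y")
    case False
    define r where "r = norm (x - y)"
    have r: "0 < r" using False by (simp add: r_def)
    \<comment> \<open>With the coordinatewise minimum as corner, the cube of side
      \<open>2 * r\<close> contains both \<open>cube x r\<close> and
      \<open>cube y r\<close>.\<close>
    define z where "z = (\<chi> i. min (x $ i) (y $ i))"
    have comp: "\<bar>x $ i - y $ i\<bar> \<le> r" for i
      using component_le_norm_cart[of "x - y" i] by (simp add: r_def)
    have sub: "cube u r \<subseteq> cube z (2 * r)" if u: "\<And>i. z $ i \<le> u $ i \<and> u $ i \<le> z $ i + r" for u
      unfolding subset_iff mem_cube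
    proof (intro allI impI)
      fix v i assume "\<forall>i. u $ i \<le> v $ i \<and> v $ i \<le> u $ i + r"
      then show "z $ i \<le> v $ i \<and> v $ i \<le> z $ i + 2 * r"
        using u[of i] by (metis add.assoc add_right_mono mult_2 order_trans)
    qed
    have "z $ i \<le> x $ i \<and> x $ i \<le> z $ i + r" "z $ i \<le> y $ i \<and> y $ i \<le> z $ i + r" for i
      using comp[of i] r by (auto simp: z_def min_def abs_le_iff)
    then have "cube x r \<subseteq> cube z (2 * r)" "cube y r \<subseteq> cube z (2 * r)"
      by (auto intro!: sub)
    then have "\<bar>average b x r - average b z (2 * r)\<bar> \<le> K2 * (2 * r) powr \<beta>"
      "\<bar>average b y r - average b z (2 * r)\<bar> \<le> K2 * (2 * r) powr \<beta>"
      using r by (intro half; simp)+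
    moreover have "(2 * r) powr \<beta> = 2 powr \<beta> * r powr \<beta>"
      using r by (simp add: powr_mult)
    ultimately have "\<bar>b x - b y\<bar> \<le> 2 * (C1 * r powr \<beta>) + 2 * (K2 * (2 powr \<beta> * r powr \<beta>))"
      using point[OF xy(1) r] point[OF xy(2) r] by simp
    also have "\<dots> = C * r powr \<beta>" by (simp add: C_def algebra_simps)
    finally show ?thesis by (simp add: r_def)
  qed simp
  have AE: "AE x in lebesgue. x \<in> S"
    using AE_average_tendsto[OF b] by (simp add: S_def)
  \<comment> \<open>The infimum in the extension is taken over \<open>S\<close>, which is nonempty
    because its complement is null.\<close>
  have "S \<noteq> {}"
  proof
    assume "S = {}"
    then have "AE x in lebesgue. x \<notin> (UNIV :: (real ^ 'n) set)" using AE by simp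
    then have "(UNIV :: (real ^ 'n) set) \<in> null_sets lebesgue"
      by (subst AE_iff_null_sets) auto
    then show False by (simp add: null_sets_def)
  qed
  then obtain g where g: "holder_continuous \<beta> g" "\<And>x. x \<in> S \<Longrightarrow> g x = b x"
    using holder_extension[OF holder C \<beta>] by blast
  have "AE x in lebesgue. b x = g x"
    using AE by eventually_elim (simp add: g)
  then show ?thesis using g(1) by (auto simp: lipschitz_space_def)
qed

section \<open>Necessity\<close>

lemma nn_integral_cube_le_maximal_function:
  fixes f :: "real ^ 'n \<Rightarrow> real"
  assumes "0 < l" "x \<in> cube z l"
  shows "(\<integral>\<^sup>+ y\<in>cube z l. ennreal \<bar>f y\<bar> \<partial>lebesgue) \<le> maximal_function f x * ennreal (l ^ CARD('n))"
  using assms maximal_function_le_iff[of f x "maximal_function f x"] by auto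

lemma maximal_function_indicator_cube:
  fixes x :: "real ^ 'n"
  assumes L: "0 < L" and x: "x \<in> cube a L"
  shows "maximal_function (indicator (cube a L)) x = 1"
proof (rule antisym)
  show "maximal_function (indicator (cube a L)) x \<le> 1"
    unfolding maximal_function_le_iff
  proof (intro allI impI)
    fix z :: "real ^ 'n" and l :: real assume zl: "0 < l" "x \<in> cube z l"
    have "(\<integral>\<^sup>+ y\<in>cube z l. ennreal \<bar>indicator (cube a L) y :: real\<bar> \<partial>lebesgue) \<le> (\<integral>\<^sup>+ y. indicator (cube z l) y \<partial>lebesgue)"
      by (intro nn_integral_mono) (auto simp: indicator_def)
    also have "\<dots> = ennreal (l ^ CARD('n))"
      using zl by (subst nn_integral_indicator) (simp_all only: cube_sets emeasure_cube less_imp_le)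
    finally show "(\<integral>\<^sup>+ y\<in>cube z l. ennreal \<bar>indicator (cube a L) y :: real\<bar> \<partial>lebesgue) \<le> 1 * ennreal (l ^ CARD('n))"
      by simp
  qed
  have "ennreal (L ^ CARD('n)) = (\<integral>\<^sup>+ y. indicator (cube a L) y \<partial>lebesgue)"
    using L by (subst nn_integral_indicator) (simp_all only: cube_sets emeasure_cube less_imp_le)
  also have "\<dots> = (\<integral>\<^sup>+ y\<in>cube a L. ennreal \<bar>indicator (cube a L) y :: real\<bar> \<partial>lebesgue)"
    by (intro nn_integral_cong) (auto simp: indicator_def)
  also have "\<dots> \<le> maximal_function (indicator (cube a L)) x * ennreal (L ^ CARD('n))"
    by (rule nn_integral_cube_le_maximal_function[OF L x])
  finally have "ennreal (L ^ CARD('n)) * inverse (ennreal (L ^ CARD('n))) \<le> maximal_function (indicator (cube a L)) x"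
    using L by (subst ennreal_mult_le_iff) auto
  also have "ennreal (L ^ CARD('n)) * inverse (ennreal (L ^ CARD('n))) = 1"
    using L by (simp add: inverse_ennreal ennreal_mult[symmetric])
  finally show "1 \<le> maximal_function (indicator (cube a L)) x" .
qed

text \<open>The intersection of cubes of sides \<open>l\<close> and \<open>L\<close> has measure at
  most the smaller of \<open>l ^ n\<close> and \<open>L ^ n\<close>. Writing the exponent
  \<open>n\<close> as \<open>lam + (n - lam)\<close> and enlarging one of the two factors bounds
  this by \<open>l powr lam * L powr (n - lam)\<close> in either case.\<close>

lemma indicator_cube_morrey:
  fixes a :: "real ^ 'n" and p lam L :: real
  assumes L: "0 < L" and p: "0 < p" and lam: "0 \<le> lam" "lam \<le> CARD('n)"
  shows "(indicator (cube a L) :: _ \<Rightarrow> real) \<in> morrey_space p lam \<and>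
    morrey_norm p lam (indicator (cube a L)) \<le> ennreal (L powr ((CARD('n) - lam) / p))"
proof (subst morrey_space_norm_le_iff)
  show "(indicator (cube a L) :: _ \<Rightarrow> real) \<in> borel_measurable lebesgue \<and> (\<forall>x l. 0 < l \<longrightarrow>
    (\<integral>\<^sup>+ y\<in>cube x l. ennreal (\<bar>indicator (cube a L) y\<bar> powr p) \<partial>lebesgue)
      \<le> ennreal ((L powr ((CARD('n) - lam) / p)) powr p * l powr lam))"
  proof (intro conjI allI impI)
    fix x :: "real ^ 'n" and l :: real assume l: "0 < l"
    have nn: "(\<integral>\<^sup>+ y. indicator (cube z r) y \<partial>lebesgue) = ennreal (r powr lam * r powr (CARD('n) - lam))"
      if "0 < r" for z :: "real ^ 'n" and r
    proof -
      have "r powr lam * r powr (CARD('n) - lam) = r ^ CARD('n)"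
        using that by (simp add: powr_add[symmetric] powr_card)
      then show ?thesis
        using that by (subst nn_integral_indicator) (simp_all only: cube_sets emeasure_cube less_imp_le)
    qed
    have "(\<integral>\<^sup>+ y\<in>cube x l. ennreal (\<bar>indicator (cube a L) y\<bar> powr p) \<partial>lebesgue) \<le> ennreal (l powr lam * L powr (CARD('n) - lam))"
    proof (cases "l \<le> L")
      case True
      have "(\<integral>\<^sup>+ y\<in>cube x l. ennreal (\<bar>indicator (cube a L) y\<bar> powr p) \<partial>lebesgue) \<le> (\<integral>\<^sup>+ y. indicator (cube x l) y \<partial>lebesgue)"
        by (intro nn_integral_mono) (auto simp: indicator_def)
      also have "\<dots> \<le> ennreal (l powr lam * L powr (CARD('n) - lam))"
        unfolding nn[OF l] using True l lam by (intro ennreal_leI mult_left_mono powr_mono2) auto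
      finally show ?thesis .
    next
      case False
      have "(\<integral>\<^sup>+ y\<in>cube x l. ennreal (\<bar>indicator (cube a L) y\<bar> powr p) \<partial>lebesgue) \<le> (\<integral>\<^sup>+ y. indicator (cube a L) y \<partial>lebesgue)"
        by (intro nn_integral_mono) (auto simp: indicator_def)
      also have "\<dots> \<le> ennreal (l powr lam * L powr (CARD('n) - lam))"
        unfolding nn[OF L] using False L lam by (intro ennreal_leI mult_right_mono powr_mono2) auto
      finally show ?thesis .
    qed
    then show "(\<integral>\<^sup>+ y\<in>cube x l. ennreal (\<bar>indicator (cube a L) y\<bar> powr p) \<partial>lebesgue)
      \<le> ennreal ((L powr ((CARD('n) - lam) / p)) powr p * l powr lam)"
      using p by (simp add: powr_powr mult.commute)
  qed auto
qed (use p in auto)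

text \<open>Boundedness controls the \<open>q\<close>-th power of the commutator of an indicator on
  its own cube. Young's inequality with \<open>c = L powr \<beta>\<close> descends to the first
  power, and both of its terms scale like \<open>L powr (n + \<beta>)\<close>. Finiteness is
  recorded as well, since \<open>enn2real\<close> would hide an infinite value.\<close>

lemma maximal_commutator_bounded_imp_oscillation:
  fixes b :: "real ^ 'n \<Rightarrow> real" and \<beta> p q lam \<mu> :: real
  assumes b: "b \<in> borel_measurable lebesgue"
    and p: "0 < p" and q: "1 \<le> q" and lam: "0 \<le> lam" "lam \<le> CARD('n)"
    and pq: "1 / q = 1 / p - \<beta> / CARD('n)" and \<mu>: "lam / p = \<mu> / q"
    and bounded: "maximal_commutator_bounded b p lam q \<mu>"
  obtains K where "0 \<le> K"
    "\<And>a L. 0 < L \<Longrightarrow> AE x in lebesgue. maximal_function (\<lambda>y. b y * indicator (cube a L) y) x < \<infinity>"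
    "\<And>a L. 0 < L \<Longrightarrow>
      (\<integral>\<^sup>+ x\<in>cube a L. ennreal \<bar>b x - enn2real (maximal_function (\<lambda>y. b y * indicator (cube a L) y) x)\<bar> \<partial>lebesgue)
      \<le> ennreal (K * L powr (CARD('n) + \<beta>))"
proof -
  obtain C where C: "0 \<le> C" and
    bd: "\<And>f. f \<in> morrey_space p lam \<Longrightarrow> (AE x in lebesgue. commutator_well_defined b f x) \<and>
        maximal_commutator b f \<in> morrey_space q \<mu> \<and>
        morrey_norm q \<mu> (maximal_commutator b f) \<le> ennreal C * morrey_norm p lam f"
    using bounded by (auto simp: maximal_commutator_bounded_def)
  show ?thesis
  proof
    show "0 \<le> 1 + C powr q" by simp
    fix a :: "real ^ 'n" and L :: real assume L: "0 < L"
    define f where "f = (indicator (cube a L) :: real ^ 'n \<Rightarrow> real)"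
    define A where "A = L powr ((CARD('n) - lam) / p)"
    have A: "0 < A" using L by (simp add: A_def)
    have f: "f \<in> morrey_space p lam" "morrey_norm p lam f \<le> ennreal A"
      using indicator_cube_morrey[OF L p lam] by (auto simp: f_def A_def)
    show "AE x in lebesgue. maximal_function (\<lambda>y. b y * indicator (cube a L) y) x < \<infinity>"
      using bd[OF f(1)] by (auto simp: commutator_well_defined_def f_def)
    have "morrey_norm q \<mu> (maximal_commutator b f) \<le> ennreal C * morrey_norm p lam f"
      using bd[OF f(1)] by blast
    also have "\<dots> \<le> ennreal (C * A)"
      using f(2) C A by (simp add: ennreal_mult mult_left_mono)
    finally have "(\<integral>\<^sup>+ y\<in>cube a L. ennreal (\<bar>maximal_commutator b f y\<bar> powr q) \<partial>lebesgue) \<le> ennreal ((C * A) powr q * L powr \<mu>)"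
      using bd[OF f(1)] morrey_space_norm_le_iff[of q "C * A" "maximal_commutator b f" \<mu>] L q C A by auto
    then have "(\<integral>\<^sup>+ y\<in>cube a L. ennreal \<bar>maximal_commutator b f y\<bar> \<partial>lebesgue) \<le>
        ennreal (L powr \<beta> * L ^ CARD('n) + (L powr \<beta>) powr (1 - q) * ((C * A) powr q * L powr \<mu>))"
      using L q by (intro nn_integral_cube_young borel_measurable_maximal_commutator b) auto
    also have "L powr \<beta> * L ^ CARD('n) + (L powr \<beta>) powr (1 - q) * ((C * A) powr q * L powr \<mu>) =
        (1 + C powr q) * L powr (CARD('n) + \<beta>)"
    proof -
      \<comment> \<open>The relation for \<open>1 / q\<close> gives
        \<open>n * q / p = n + \<beta> * q\<close>; the terms with \<open>lam\<close> and
        \<open>\<mu>\<close> cancel.\<close>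
      have "\<beta> * (1 - q) + ((CARD('n) - lam) / p * q + \<mu>) = CARD('n) + \<beta>"
      proof -
        have "q / p - \<beta> * q / CARD('n) = 1" "\<mu> = lam * q / p"
          using pq \<mu> q p by (auto simp: field_simps)
        then have "CARD('n) * (q / p) = CARD('n) + \<beta> * q"
          by (simp add: field_simps)
        then show ?thesis
          using \<open>\<mu> = _\<close> by (simp add: algebra_simps diff_divide_distrib)
      qed
      then have "(L powr \<beta>) powr (1 - q) * ((C * A) powr q * L powr \<mu>) = C powr q * L powr (CARD('n) + \<beta>)"
        using C A by (simp add: A_def powr_mult powr_powr powr_add[symmetric])
      then show ?thesis using L by (simp add: powr_card powr_add distrib_right)
    qed
    also have "(\<integral>\<^sup>+ y\<in>cube a L. ennreal \<bar>maximal_commutator b f y\<bar> \<partial>lebesgue) =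
        (\<integral>\<^sup>+ x\<in>cube a L. ennreal \<bar>b x - enn2real (maximal_function (\<lambda>y. b y * indicator (cube a L) y) x)\<bar> \<partial>lebesgue)"
    proof (rule nn_integral_cong)
      fix x
      show "ennreal \<bar>maximal_commutator b f x\<bar> * indicator (cube a L) x =
          ennreal \<bar>b x - enn2real (maximal_function (\<lambda>y. b y * indicator (cube a L) y) x)\<bar> * indicator (cube a L) x"
        using maximal_function_indicator_cube[OF L, of x a]
        by (cases "x \<in> cube a L") (auto simp: maximal_commutator_def f_def)
    qed
    finally show "(\<integral>\<^sup>+ x\<in>cube a L. ennreal \<bar>b x - enn2real (maximal_function (\<lambda>y. b y * indicator (cube a L) y) x)\<bar> \<partial>lebesgue)
      \<le> ennreal ((1 + C powr q) * L powr (CARD('n) + \<beta>))" .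
  qed
qed

section \<open>Lower bounds for the maximal function of \<open>b\<close> cut off to a cube\<close>

lemma AE_cube_interior: "AE x in lebesgue. x \<in> cube a L \<longrightarrow> x \<in> box a (\<chi> i. a $ i + L)"
  for a :: "real ^ 'n"
proof (rule AE_I')
  show "cube a L - box a (\<chi> i. a $ i + L) \<in> null_sets lebesgue"
    unfolding cube_def using negligible_frontier_interval negligible_iff_null_sets by blast
qed auto

lemma average_le_maximal_function:
  fixes b :: "real ^ 'n \<Rightarrow> real"
  assumes b: "locally_integrable b" and h: "0 < h" and sub: "cube z h \<subseteq> cube a L" and x: "x \<in> cube z h"
    and fin: "maximal_function (\<lambda>y. b y * indicator (cube a L) y) x < \<infinity>"
  shows "average (\<lambda>y. \<bar>b y\<bar>) z h \<le> enn2real (maximal_function (\<lambda>y. b y * indicator (cube a L) y) x)"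
proof -
  let ?M = "maximal_function (\<lambda>y. b y * indicator (cube a L) y) x"
  obtain m where m: "0 \<le> m" "?M = ennreal m"
    using fin by (cases ?M) auto
  have "ennreal (LINT y:cube z h|lebesgue. \<bar>b y\<bar>) = (\<integral>\<^sup>+ y\<in>cube z h. ennreal \<bar>b y\<bar> \<partial>lebesgue)"
    by (rule nn_integral_cube_eq_LINT[symmetric]) (auto intro: locally_integrable_abs b)
  also have "\<dots> = (\<integral>\<^sup>+ y\<in>cube z h. ennreal \<bar>b y * indicator (cube a L) y\<bar> \<partial>lebesgue)"
    using sub by (intro nn_integral_cong) (auto simp: indicator_def)
  also have "\<dots> \<le> ?M * ennreal (h ^ CARD('n))"
    by (rule nn_integral_cube_le_maximal_function[OF h x])
  also have "\<dots> = ennreal (m * h ^ CARD('n))"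
    using m h by (simp add: ennreal_mult)
  finally have "(LINT y:cube z h|lebesgue. \<bar>b y\<bar>) \<le> m * h ^ CARD('n)"
    using m h by (subst (asm) ennreal_le_iff) auto
  then show ?thesis
    using h m by (simp add: average_def divide_le_eq)
qed

text \<open>At an interior point, small cubes with lower corner \<open>x\<close> stay inside
  \<open>cube a L\<close>. The averages of \<open>\<bar>b\<bar>\<close> over them are bounded by the
  maximal function at \<open>x\<close> and tend to \<open>\<bar>b x\<bar>\<close> almost
  everywhere.\<close>

lemma abs_le_maximal_function:
  fixes b :: "real ^ 'n \<Rightarrow> real"
  assumes b: "locally_integrable b"
    and fin: "AE x in lebesgue. maximal_function (\<lambda>y. b y * indicator (cube a L) y) x < \<infinity>"
  shows "AE x in lebesgue. x \<in> cube a L \<longrightarrow>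
    \<bar>b x\<bar> \<le> enn2real (maximal_function (\<lambda>y. b y * indicator (cube a L) y) x)"
  using AE_cube_interior[of a L] AE_average_tendsto[OF locally_integrable_abs[OF b]] fin
proof eventually_elim
  case (elim x)
  show ?case
  proof
    assume "x \<in> cube a L"
    then have x: "a $ i < x $ i" "x $ i < a $ i + L" for i
      using elim(1) by (auto simp: mem_box_cart)
    define d where "d = Min (range (\<lambda>i. a $ i + L - x $ i))"
    have d: "0 < d" unfolding d_def using x by (subst Min_gr_iff) auto
    have di: "d \<le> a $ i + L - x $ i" for i unfolding d_def by (rule Min_le) auto
    have "\<forall>\<^sub>F h in at_right 0. 0 < h \<and> h < d"
      using d by (intro eventually_conj eventually_at_right_less) (auto simp: eventually_at_right_field)
    then have "\<forall>\<^sub>F h in at_right 0. average (\<lambda>y. \<bar>b y\<bar>) x h \<le> enn2real (maximal_function (\<lambda>y. b y * indicator (cube a L) y) x)"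
    proof eventually_elim
      case (elim h)
      have "cube x h \<subseteq> cube a L"
        unfolding subset_iff mem_cube
      proof (intro allI impI)
        fix y i assume y: "\<forall>i. x $ i \<le> y $ i \<and> y $ i \<le> x $ i + h"
        show "a $ i \<le> y $ i \<and> y $ i \<le> a $ i + L"
          using y[rule_format, of i] x[of i] di[of i] elim by linarith
      qed
      moreover have "x \<in> cube x h" using elim by (simp add: mem_cube)
      ultimately show ?case
        using b elim \<open>maximal_function (\<lambda>y. b y * indicator (cube a L) y) x < \<infinity>\<close>
        by (intro average_le_maximal_function) auto
    qed
    then show "\<bar>b x\<bar> \<le> enn2real (maximal_function (\<lambda>y. b y * indicator (cube a L) y) x)"
      by (intro tendsto_upperbound[OF elim(2)]) auto
  qed
qed

text \<open>The majorant \<open>v\<close> will involve a maximal function; it enters only through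
  its nonnegative integral, so that its Lebesgue integrability does not have to be
  established.\<close>

lemma LINT_cube_le:
  fixes u :: "real ^ 'n \<Rightarrow> real"
  assumes u: "locally_integrable u" "\<And>y. 0 \<le> u y"
    and le: "AE y in lebesgue. y \<in> cube a L \<longrightarrow> u y \<le> v y"
    and v: "(\<integral>\<^sup>+ y\<in>cube a L. ennreal (v y) \<partial>lebesgue) \<le> ennreal B" "0 \<le> B"
  shows "(LINT y:cube a L|lebesgue. u y) \<le> B"
proof -
  have "ennreal (LINT y:cube a L|lebesgue. u y) = (\<integral>\<^sup>+ y\<in>cube a L. ennreal (u y) \<partial>lebesgue)"
    using u by (rule nn_integral_cube_eq_LINT[symmetric])
  also have "\<dots> \<le> (\<integral>\<^sup>+ y\<in>cube a L. ennreal (v y) \<partial>lebesgue)"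
    using le by (intro nn_integral_mono_AE, eventually_elim) (auto simp: indicator_def ennreal_leI)
  also note v(1)
  finally show ?thesis using v(2) by (subst (asm) ennreal_le_iff) auto
qed

lemma maximal_commutator_bounded_imp_lipschitz:
  fixes b :: "real ^ 'n \<Rightarrow> real" and \<beta> p q lam \<mu> :: real
  assumes b: "locally_integrable b" and \<beta>: "0 < \<beta>" "\<beta> \<le> 1"
    and p: "0 < p" and q: "1 \<le> q" and lam: "0 \<le> lam" "lam \<le> CARD('n)"
    and pq: "1 / q = 1 / p - \<beta> / CARD('n)" and \<mu>: "lam / p = \<mu> / q"
    and bounded: "maximal_commutator_bounded b p lam q \<mu>"
  shows "b \<in> lipschitz_space \<beta>" and "AE x in lebesgue. 0 \<le> b x"
proof -
  define m where "m a L x = enn2real (maximal_function (\<lambda>y. b y * indicator (cube a L) y) x)" for a L x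
  obtain K where K: "0 \<le> K"
    and fin: "\<And>a L. 0 < L \<Longrightarrow> AE x in lebesgue. maximal_function (\<lambda>y. b y * indicator (cube a L) y) x < \<infinity>"
    and osc: "\<And>a L. 0 < L \<Longrightarrow> (\<integral>\<^sup>+ x\<in>cube a L. ennreal \<bar>b x - m a L x\<bar> \<partial>lebesgue) \<le> ennreal (K * L powr (CARD('n) + \<beta>))"
    unfolding m_def
    using maximal_commutator_bounded_imp_oscillation[OF borel_measurable_locally_integrable[OF b] p q lam pq \<mu> bounded]
    by blast
  note li_abs = locally_integrable_abs[OF b]
  \<comment> \<open>\<open>w\<close> is twice the negative part of \<open>b\<close>. Since
    \<open>b \<le> \<bar>b\<bar> \<le> m\<close> almost everywhere on the cube,
    \<open>w \<le> \<bar>b - m\<bar>\<close> there, so averages of \<open>w\<close> over cubes of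
    side \<open>h\<close> are at most \<open>K * h powr \<beta>\<close> and \<open>w\<close>
    vanishes at its Lebesgue points.\<close>
  define w where "w y = \<bar>b y\<bar> - b y" for y
  have w: "locally_integrable w" "\<And>y. 0 \<le> w y"
    unfolding w_def[abs_def] using locally_integrable_diff[OF li_abs b] by auto
  have w_int: "(LINT y:cube a L|lebesgue. w y) \<le> K * L powr (CARD('n) + \<beta>)" if L: "0 < L" for a L
  proof (rule LINT_cube_le[OF w _ osc[OF L]])
    show "AE y in lebesgue. y \<in> cube a L \<longrightarrow> w y \<le> \<bar>b y - m a L y\<bar>"
      using abs_le_maximal_function[OF b fin[OF L, of a]]
      by eventually_elim (auto simp: w_def m_def)
  qed (use K in simp)
  show "AE x in lebesgue. 0 \<le> b x"
    using AE_average_tendsto[OF w(1)]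
  proof eventually_elim
    case (elim x)
    have "\<forall>\<^sub>F h in at_right 0. average w x h \<le> K * h powr \<beta>"
      using eventually_at_right_less[of "0::real"]
    proof eventually_elim
      case (elim h)
      then show ?case using w_int[OF elim, of x]
        by (simp add: average_def powr_add powr_card[symmetric] divide_le_eq mult_ac)
    qed
    moreover have "((\<lambda>h. K * h powr \<beta>) \<longlongrightarrow> K * 0 powr \<beta>) (at_right 0)"
    proof (rule tendsto_mult[OF tendsto_const tendsto_powr2[OF tendsto_ident_at tendsto_const]])
      show "\<forall>\<^sub>F h in at_right 0. 0 \<le> (h::real)"
        using eventually_at_right_less[of "0::real"] by eventually_elim simp
    qed (use \<beta> in auto)
    ultimately have "w x \<le> K * 0 powr \<beta>"
      by (intro tendsto_le[OF _ _ elim]) auto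
    then show ?case using \<beta> by (simp add: w_def)
  qed
  show "b \<in> lipschitz_space \<beta>"
  proof (rule campanato[OF b \<beta>])
    show "0 \<le> 2 * K" using K by simp
    fix a :: "real ^ 'n" and L :: real assume L: "0 < L"
    define c where "c = average b a L"
    have li: "locally_integrable (\<lambda>y. b y - c)"
      by (intro locally_integrable_diff b locally_integrable_const)
    have li': "locally_integrable (\<lambda>y. \<bar>b y - c\<bar> - (b y - c))"
      by (intro locally_integrable_diff locally_integrable_abs li)
    have c_le: "c \<le> average (\<lambda>y. \<bar>b y\<bar>) a L"
      unfolding c_def average_def using L set_integrable_cube[OF b] set_integrable_cube[OF li_abs]
      by (intro divide_right_mono set_integral_mono) auto
    have zero: "(LINT y:cube a L|lebesgue. b y - c) = 0"
      using L set_integrable_cube[OF b] set_integrable_cube[OF locally_integrable_const]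
      by (simp add: set_integral_diff LINT_cube_const c_def average_def)
    \<comment> \<open>The integrand is twice the part of \<open>b\<close> below its average
      \<open>c\<close>. As \<open>c\<close> is at most the average of \<open>\<bar>b\<bar>\<close>,
      hence at most \<open>m\<close>, that part is bounded by \<open>\<bar>b - m\<bar>\<close>. The
      integral of \<open>b - c\<close> being zero, this is already the full mean
      oscillation.\<close>
    have "(LINT y:cube a L|lebesgue. \<bar>b y - c\<bar> - (b y - c)) \<le> 2 * (K * L powr (CARD('n) + \<beta>))"
    proof (rule LINT_cube_le[OF li', where v = "\<lambda>y. 2 * \<bar>b y - m a L y\<bar>"])
      show "AE y in lebesgue. y \<in> cube a L \<longrightarrow> \<bar>b y - c\<bar> - (b y - c) \<le> 2 * \<bar>b y - m a L y\<bar>"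
        using fin[OF L, of a]
      proof eventually_elim
        case (elim y)
        show ?case
        proof
          assume "y \<in> cube a L"
          then have "average (\<lambda>y. \<bar>b y\<bar>) a L \<le> m a L y"
            unfolding m_def using L elim b by (intro average_le_maximal_function) auto
          then show "\<bar>b y - c\<bar> - (b y - c) \<le> 2 * \<bar>b y - m a L y\<bar>" using c_le by (simp add: abs_if)
        qed
      qed
      have "(\<lambda>y. ennreal \<bar>b y - m a L y\<bar> * indicator (cube a L) y) \<in> borel_measurable lebesgue"
        using borel_measurable_locally_integrable[OF b] unfolding m_def by measurable
      then have "(\<integral>\<^sup>+ y\<in>cube a L. ennreal (2 * \<bar>b y - m a L y\<bar>) \<partial>lebesgue) = ennreal 2 * (\<integral>\<^sup>+ y\<in>cube a L. ennreal \<bar>b y - m a L y\<bar> \<partial>lebesgue)"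
        by (subst nn_integral_cmult[symmetric]) (auto simp: ennreal_mult mult.assoc)
      also have "\<dots> \<le> ennreal 2 * ennreal (K * L powr (CARD('n) + \<beta>))"
        using osc[OF L] by (intro mult_left_mono) auto
      also have "\<dots> = ennreal (2 * (K * L powr (CARD('n) + \<beta>)))"
        using K by (intro ennreal_mult[symmetric]) auto
      finally show "(\<integral>\<^sup>+ y\<in>cube a L. ennreal (2 * \<bar>b y - m a L y\<bar>) \<partial>lebesgue) \<le> \<dots>" .
    qed (use K in auto)
    then show "(LINT y:cube a L|lebesgue. \<bar>b y - average b a L\<bar>) \<le> 2 * K * L powr (CARD('n) + \<beta>)"
      using zero set_integrable_cube[OF li] set_integrable_cube[OF locally_integrable_abs[OF li]]
      by (simp add: set_integral_diff c_def)
  qed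
qed

theorem theorem1p7:
  fixes b :: "real ^ 'n \<Rightarrow> real" and \<beta> p q lam \<mu> :: real
  assumes "locally_integrable b"
    and "0 < \<beta>" and "\<beta> < 1"
    and "1 < p" and "p < real CARD('n) / \<beta>"
    and "0 < lam" and "lam < real CARD('n) - \<beta> * p"
    and "1 / q = 1 / p - \<beta> / real CARD('n)"
    and "lam / p = \<mu> / q"
  shows "(b \<in> lipschitz_space \<beta> \<and> (AE x in lebesgue. 0 \<le> b x)) \<longleftrightarrow>
    maximal_commutator_bounded b p lam q \<mu>"
proof
  assume "b \<in> lipschitz_space \<beta> \<and> (AE x in lebesgue. 0 \<le> b x)"
  then show "maximal_commutator_bounded b p lam q \<mu>"
    using assms by (intro lipschitz_imp_maximal_commutator_bounded) auto
next
  assume bounded: "maximal_commutator_bounded b p lam q \<mu>"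
  have n: "0 < real CARD('n)" by simp
  have "\<beta> * p < real CARD('n)"
    using assms(2,5) by (simp add: less_divide_eq mult.commute)
  then have "0 < 1 / q"
    unfolding assms(8) using assms(4) n by (simp add: field_simps)
  moreover have "1 / q \<le> 1"
  proof -
    have "1 / p \<le> 1" "0 \<le> \<beta> / real CARD('n)" using assms(2,4) by auto
    then show ?thesis unfolding assms(8) by linarith
  qed
  \<comment> \<open>Young's inequality with exponent \<open>q\<close> requires this. Positivity of
    \<open>1 / q\<close> is the condition \<open>p < n / \<beta>\<close>, and
    \<open>1 / q \<le> 1 / p\<close> gives the rest.\<close>
  ultimately have q: "1 \<le> q" by (simp add: divide_le_eq)
  have "0 < \<beta> * p" using assms(2,4) by simp
  then have "lam \<le> real CARD('n)" using assms(7) by linarith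
  then show "b \<in> lipschitz_space \<beta> \<and> (AE x in lebesgue. 0 \<le> b x)"
    using maximal_commutator_bounded_imp_lipschitz[of b \<beta> p q lam \<mu>] assms q bounded by auto
qed

end
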